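(* Let $\Omega\Subset\mathbb{C}^2$ be a bounded, smoothly bounded domain. If $\Omega$ is sesquiconvex, then $\Omega$ admits a smooth global defining function $\rho\colon U\to\mathbb{R}$ which is plurisubharmonic on $\bar\Omega\cap U$.
   Context: "Smooth" means $\mathcal{C}^\infty$; "smoothly bounded" means that $b\Omega$ is smooth. A smooth function $\rho\colon U\to\mathbb{R}$ is a (global) defining function for $\Omega$ if $U$ is an open neighborhood of $b\Omega$, $\Omega\cap U=\{\rho<0\}$, and $d\rho\ne0$ on $b\Omega$; it is a local defining function near $p_0\in b\Omega$ if instead $U$ is an open neighborhood of $p_0$, with $\Omega\cap U=\{\rho<0\}$ and $d\rho\neq 0$ on $b\Omega\cap U$. Coordinates are $(z,w)=(z^1,z^2)$. For $(1,0)$ vector fields, $H_f(A,B)=\sum_{j,k}\frac{\partial^2f}{\partial z^j\partial\bar z^k}A^j\overline{B^k}$. For real vector fields $V,W$ on an open subset of $\mathbb{C}^2\cong\mathbb{R}^4$ with real coordinates $t^1,\dots,t^4$, $Q_f(V,W)=\sum_{\mu,\kappa}\frac{\partial^2f}{\partial t^\mu\partial t^\kappa}V^\mu W^\kappa$ (real Hessian). A "holomorphic tangential vector field" is a smooth $(1,0)$ vector field $L$ with $L\rho=0$ on $b\Omega$. $\Omega$ is pseudoconvex at $p_0$ if $H_\rho(L,L)\ge0$ on $b\Omega$ near $p_0$ for all holomorphic tangential $L$. "$\rho$ is plurisubharmonic on $\bar\Omega\cap U$" means that the complex Hessian of $\rho$ is positive semi-definite at every point $q\in\bar\Omega\cap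 U$. For a local defining function $\rho\colon U\to\mathbb{R}$, let $L$ be a nonvanishing holomorphic tangential vector field on $U$ and $N=N_\rho=\frac{1}{\sqrt{|\rho_z|^2+|\rho_w|^2}}\big(\rho_{\bar z}\frac{\partial}{\partial z}+\rho_{\bar w}\frac{\partial}{\partial w}\big)$; write $L=\frac12(X+iY)$, $N=\frac12(\nu+iT)$ with real vector fields $X,Y,\nu,T$. $\Omega$ is sesquiconvex at $p_0\in b\Omega$ if $\Omega$ is pseudoconvex at $p_0$ and there exists a smooth local defining function $\rho\colon U\to\mathbb{R}$ for $\Omega$ near $p_0$ such that $$Q_\rho(Y,T)^2+Q_\rho(X,T)^2=\mathcal{O}(H_\rho(L,L))\quad\text{on } b\Omega\cap U,$$ where "$f=\mathcal{O}(g)$ on $b\Omega\cap U$" means: for every $K\Subset b\Omega\cap U$ there is $C>0$ with $|f|\le C|g|$ on $K$. $\Omega$ is sesquiconvex if it is sesquiconvex at every point of $b\Omega$. *)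

theory Defs
  imports "HOL-Analysis.Analysis" "HOL-Library.Complex_Order"
begin

type_synonym C2 = "complex ^ 2"

section \<open>Smooth functions and differential operators\<close>

definition dir_deriv :: "('a::real_normed_vector \<Rightarrow> 'b::real_normed_vector) \<Rightarrow> 'a \<Rightarrow> 'a \<Rightarrow> 'b"
  where "dir_deriv f v = (\<lambda>q. frechet_derivative f (at q) v)"

text \<open>Meaningful for open sets: in finite dimensions, the continuity of all directional
  derivatives is the continuity of the total derivative.\<close>

primrec C_k_on :: "nat \<Rightarrow> 'a::euclidean_space set \<Rightarrow> ('a \<Rightarrow> 'b::euclidean_space) \<Rightarrow> bool" where
  "C_k_on 0 U f \<longleftrightarrow> continuous_on U f"
| "C_k_on (Suc n) U f \<longleftrightarrow> (\<forall>q\<in>U. f differentiable (at q)) \<and> (\<forall>v. C_k_on n U (dir_deriv f v))"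

definition smooth_on :: "'a::euclidean_space set \<Rightarrow> ('a \<Rightarrow> 'b::euclidean_space) \<Rightarrow> bool"
  where "smooth_on U f \<longleftrightarrow> (\<forall>n. C_k_on n U f)"

text \<open>With \<open>z\<^sup>j = x\<^sup>j + \<i> y\<^sup>j\<close>, the coordinate vector fields of \<open>x\<^sup>j\<close> and \<open>y\<^sup>j\<close> are
  \<^term>\<open>axis j 1\<close> and \<^term>\<open>axis j \<i>\<close>.\<close>

definition dz :: "2 \<Rightarrow> (C2 \<Rightarrow> complex) \<Rightarrow> C2 \<Rightarrow> complex"
  where "dz j f = (\<lambda>q. (dir_deriv f (axis j 1) q - \<i> * dir_deriv f (axis j \<i>) q) / 2)"

definition dzbar :: "2 \<Rightarrow> (C2 \<Rightarrow> complex) \<Rightarrow> C2 \<Rightarrow> complex"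
  where "dzbar j f = (\<lambda>q. (dir_deriv f (axis j 1) q + \<i> * dir_deriv f (axis j \<i>) q) / 2)"

abbreviation cplx :: "(C2 \<Rightarrow> real) \<Rightarrow> C2 \<Rightarrow> complex"
  where "cplx f \<equiv> (\<lambda>q. complex_of_real (f q))"

text \<open>In the following, \<open>A\<close>, \<open>B\<close>, \<open>V\<close>, \<open>W\<close> are values of vector fields at the point \<open>q\<close>.  A (1,0) vector
  \<open>\<Sum>j. A\<^sup>j \<partial>/\<partial>z\<^sup>j\<close> is represented by its coefficient vector \<open>A\<close>, and a real vector by the
  corresponding element of \<^typ>\<open>C2\<close> regarded as a real Euclidean space, whose standard basis
  is \<^const>\<open>Basis\<close>.\<close>

definition complex_hessian :: "(C2 \<Rightarrow> real) \<Rightarrow> C2 \<Rightarrow> C2 \<Rightarrow> C2 \<Rightarrow> complex"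
  where "complex_hessian f q A B =
    (\<Sum>j\<in>UNIV. \<Sum>k\<in>UNIV. dz j (dzbar k (cplx f)) q * A $ j * cnj (B $ k))"

definition real_hessian :: "(C2 \<Rightarrow> real) \<Rightarrow> C2 \<Rightarrow> C2 \<Rightarrow> C2 \<Rightarrow> real"
  where "real_hessian f q V W =
    (\<Sum>b\<in>Basis. \<Sum>c\<in>Basis. dir_deriv (dir_deriv f c) b q * (V \<bullet> b) * (W \<bullet> c))"

definition holo_apply :: "C2 \<Rightarrow> (C2 \<Rightarrow> complex) \<Rightarrow> C2 \<Rightarrow> complex"
  where "holo_apply A f q = (\<Sum>j\<in>UNIV. A $ j * dz j f q)"

text \<open>The real vectors \<open>X\<close>, \<open>Y\<close> in the decomposition \<open>A = (X + \<i> Y) / 2\<close> of a (1,0) vector \<open>A\<close>.  For a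
  coefficient \<open>a + \<i> b\<close>, \<open>(a + \<i> b) \<partial>/\<partial>z = ((a \<partial>/\<partial>x + b \<partial>/\<partial>y) + \<i> (b \<partial>/\<partial>x - a \<partial>/\<partial>y)) / 2\<close>;
  see \<open>holo_apply_decomp\<close> below.\<close>

definition re_field :: "C2 \<Rightarrow> C2" where "re_field A = A"
definition im_field :: "C2 \<Rightarrow> C2" where "im_field A = (- \<i>) *s A"

lemma holo_apply_decomp:
  assumes "f differentiable (at q)"
  shows "holo_apply A f q = (dir_deriv f (re_field A) q + \<i> * dir_deriv f (im_field A) q) / 2"
proof -
  have lin: "linear (frechet_derivative f (at q))"
    using assms by (rule linear_frechet_derivative)
  have expand: "dir_deriv f V q = (\<Sum>j\<in>UNIV. of_real (Re (V $ j)) * dir_deriv f (axis j 1) q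
      + of_real (Im (V $ j)) * dir_deriv f (axis j \<i>) q)" for V
  proof -
    have "V = (\<Sum>j\<in>UNIV. Re (V $ j) *\<^sub>R axis j 1 + Im (V $ j) *\<^sub>R axis j \<i>)"
      by (auto simp: vec_eq_iff axis_def complex_eq_iff if_distrib cong: if_cong)
    then have "dir_deriv f V q = frechet_derivative f (at q)
        (\<Sum>j\<in>UNIV. Re (V $ j) *\<^sub>R axis j 1 + Im (V $ j) *\<^sub>R axis j \<i>)"
      by (simp add: dir_deriv_def)
    then show ?thesis
      by (simp add: dir_deriv_def linear_sum[OF lin] linear_add[OF lin] linear_cmul[OF lin]
          scaleR_conv_of_real[where 'a = complex])
  qed
  have A: "A $ j = of_real (Re (A $ j)) + \<i> * of_real (Im (A $ j))" for j
    by (simp add: complex_eq_iff)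
  show ?thesis
    unfolding holo_apply_def dz_def expand[of "re_field A"] expand[of "im_field A"]
    by (subst A) (simp add: re_field_def im_field_def sum_2 field_simps)
qed


section \<open>Defining functions and boundary geometry\<close>

definition smooth_hypersurface :: "C2 set \<Rightarrow> bool" where
  "smooth_hypersurface S \<longleftrightarrow> (\<forall>p\<in>S. \<exists>U (r :: C2 \<Rightarrow> real). open U \<and> p \<in> U \<and> smooth_on U r \<and>
     S \<inter> U = {q\<in>U. r q = 0} \<and> (\<forall>q\<in>S \<inter> U. frechet_derivative r (at q) \<noteq> (\<lambda>v. 0)))"

definition smoothly_bounded_domain :: "C2 set \<Rightarrow> bool" where
  "smoothly_bounded_domain \<Omega> \<longleftrightarrow> open \<Omega> \<and> connected \<Omega> \<and> \<Omega> \<noteq> {} \<and> bounded \<Omega> \<and>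
     smooth_hypersurface (frontier \<Omega>)"

definition defining_on :: "C2 set \<Rightarrow> C2 set \<Rightarrow> (C2 \<Rightarrow> real) \<Rightarrow> bool" where
  "defining_on \<Omega> U \<rho> \<longleftrightarrow> open U \<and> smooth_on U \<rho> \<and> \<Omega> \<inter> U = {q\<in>U. \<rho> q < 0} \<and>
     (\<forall>q\<in>frontier \<Omega> \<inter> U. frechet_derivative \<rho> (at q) \<noteq> (\<lambda>v. 0))"

definition global_defining_function :: "C2 set \<Rightarrow> C2 set \<Rightarrow> (C2 \<Rightarrow> real) \<Rightarrow> bool" where
  "global_defining_function \<Omega> U \<rho> \<longleftrightarrow> frontier \<Omega> \<subseteq> U \<and> defining_on \<Omega> U \<rho>"

definition local_defining_function :: "C2 set \<Rightarrow> C2 \<Rightarrow> C2 set \<Rightarrow> (C2 \<Rightarrow> real) \<Rightarrow> bool" where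
  "local_defining_function \<Omega> p U \<rho> \<longleftrightarrow> p \<in> U \<and> defining_on \<Omega> U \<rho>"

definition holo_tangential :: "C2 set \<Rightarrow> (C2 \<Rightarrow> real) \<Rightarrow> C2 set \<Rightarrow> (C2 \<Rightarrow> C2) \<Rightarrow> bool" where
  "holo_tangential \<Omega> \<rho> U L \<longleftrightarrow> smooth_on U L \<and>
     (\<forall>q\<in>frontier \<Omega> \<inter> U. holo_apply (L q) (cplx \<rho>) q = 0)"

text \<open>The order on \<^typ>\<open>complex\<close> is that of \<^theory>\<open>HOL-Library.Complex_Order\<close>:
  \<open>0 \<le> c\<close> means that \<open>c\<close> is real and nonnegative.\<close>

definition pseudoconvex_at :: "C2 set \<Rightarrow> C2 \<Rightarrow> bool" where
  "pseudoconvex_at \<Omega> p \<longleftrightarrow> (\<exists>U \<rho>. local_defining_function \<Omega> p U \<rho> \<and>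
     (\<exists>V. open V \<and> p \<in> V \<and> V \<subseteq> U \<and>
       (\<forall>L. holo_tangential \<Omega> \<rho> V L \<longrightarrow>
         (\<forall>q\<in>frontier \<Omega> \<inter> V. 0 \<le> complex_hessian \<rho> q (L q) (L q)))))"

definition plurisubharmonic_on :: "C2 set \<Rightarrow> (C2 \<Rightarrow> real) \<Rightarrow> bool" where
  "plurisubharmonic_on S \<rho> \<longleftrightarrow> (\<forall>q\<in>S. \<forall>A. 0 \<le> complex_hessian \<rho> q A A)"


section \<open>Sesquiconvexity\<close>

definition big_O_on :: "C2 set \<Rightarrow> (C2 \<Rightarrow> 'a::real_normed_vector) \<Rightarrow> (C2 \<Rightarrow> 'b::real_normed_vector) \<Rightarrow> bool"
  where "big_O_on S f g \<longleftrightarrow>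
    (\<forall>K. compact (closure K) \<and> closure K \<subseteq> S \<longrightarrow> (\<exists>C>0. \<forall>q\<in>K. norm (f q) \<le> C * norm (g q)))"

definition normal_field :: "(C2 \<Rightarrow> real) \<Rightarrow> C2 \<Rightarrow> C2" where
  "normal_field \<rho> q =
    (1 / sqrt (\<Sum>j\<in>UNIV. (cmod (dz j (cplx \<rho>) q))\<^sup>2)) *\<^sub>R (\<chi> j. dzbar j (cplx \<rho>) q)"

text \<open>The condition does not depend on the choice of the nonvanishing tangential field \<open>L\<close>.  It is
  quantified existentially so that it cannot hold vacuously on a neighbourhood \<open>U\<close> that admits
  no such field.\<close>

definition sesquiconvex_at :: "C2 set \<Rightarrow> C2 \<Rightarrow> bool" where
  "sesquiconvex_at \<Omega> p \<longleftrightarrow> pseudoconvex_at \<Omega> p \<and>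
     (\<exists>U \<rho> L. local_defining_function \<Omega> p U \<rho> \<and> holo_tangential \<Omega> \<rho> U L \<and> (\<forall>q\<in>U. L q \<noteq> 0) \<and>
       (let X = (\<lambda>q. re_field (L q)); Y = (\<lambda>q. im_field (L q));
            T = (\<lambda>q. im_field (normal_field \<rho> q))
        in big_O_on (frontier \<Omega> \<inter> U)
             (\<lambda>q. (real_hessian \<rho> q (Y q) (T q))\<^sup>2 + (real_hessian \<rho> q (X q) (T q))\<^sup>2)
             (\<lambda>q. complex_hessian \<rho> q (L q) (L q))))"

definition sesquiconvex :: "C2 set \<Rightarrow> bool" where
  "sesquiconvex \<Omega> \<longleftrightarrow> (\<forall>p\<in>frontier \<Omega>. sesquiconvex_at \<Omega> p)"

end

(* With Q the real Hessian of the signed distance d and J the complex structure, the complex Hessian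
   of d is (Q(a,a) + Q(Ja,Ja)) / 4.  Since Q annihilates the normal, its mixed tangential-normal part
   only involves Q(X,T) and Q(Y,T); on tangent vectors the Hessian of any local defining function rho
   is |grad rho| Q.  Sesquiconvexity thus bounds the mixed part by the
   square root of the Levi form, and by Cauchy-Schwarz d + M d^2 has positive semi-definite complex
   Hessian on the boundary for large M.  This propagates to the inside because Q can only increase
   along the inward normals (Riccati equation), whereas grad d is constant along them. *)
theory Submission
  imports Defs
begin

section \<open>Calculus of smooth functions\<close>

text \<open>Sesquiconvexity may name a different defining function at every boundary point. The
  signed distance is one canonical function to which all these estimates transfer, so compactness of
  the boundary is enough and no partition of unity enters. The transfer works because T, the rotated
  normal, is itself tangent to the boundary: only tangential entries of the Hessian of rho occur.
  The obstacle is the interior. Where the Levi form degenerates, an error proportional to the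
  distance in complex tangential directions could not be absorbed, since the favourable term from M
  d^2 sees only the complex normal component. Monotonicity of the Hessian along normals produces no
  such error. Let E be the squared modulus of the complex normal component of a vector. On the inner
  side the Levi form of d stays above -M E, the factor 1 + 2 M d of that form lies in (0, 1], and
  the square contributes 2 M E. Hence M E remains, and M can be the very constant of the boundary
  estimate.\<close>

lemma dir_deriv_eq:
  "(f has_derivative f') (at q) \<Longrightarrow> dir_deriv f v q = f' v"
  by (simp add: dir_deriv_def frechet_derivative_at[symmetric])

lemma has_derivative_dir_deriv:
  "f differentiable (at q) \<Longrightarrow> (f has_derivative (\<lambda>v. dir_deriv f v q)) (at q)"
  unfolding dir_deriv_def frechet_derivative_works by simp

lemma linear_dir_deriv:
  "f differentiable (at q) \<Longrightarrow> linear (\<lambda>v. dir_deriv f v q)"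
  using has_derivative_dir_deriv has_derivative_linear by blast

lemma dir_deriv_local:
  assumes "open U" "q \<in> U" "\<And>x. x \<in> U \<Longrightarrow> f x = g x"
  shows "dir_deriv f v q = dir_deriv g v q"
proof -
  have "(f has_derivative F) (at q) \<longleftrightarrow> (g has_derivative F) (at q)" for F
    using has_derivative_transform_within_open[OF _ assms(1,2)] assms(3) by metis
  then show ?thesis
    by (simp add: dir_deriv_def frechet_derivative_def)
qed

text \<open>Derivatives depend only on germs, so equality on an open set suffices. The closure
  lemmas use this to replace \<open>dir_deriv\<close> of a compound function, computed only on
  \<open>U\<close>, by its explicit formula.\<close>

lemma C_k_on_cong:
  assumes "open U" "\<And>x. x \<in> U \<Longrightarrow> f x = g x" "C_k_on n U f"
  shows "C_k_on n U g"
  using assms(2,3)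
proof (induction n arbitrary: f g)
  case 0
  then show ?case by (auto cong: continuous_on_cong)
next
  case (Suc n)
  have "g differentiable (at q)" if "q \<in> U" for q
  proof -
    have "f differentiable (at q)"
      using Suc.prems that by simp
    then obtain F where "(f has_derivative F) (at q)"
      unfolding differentiable_def by blast
    from has_derivative_transform_within_open[OF this \<open>open U\<close> that] Suc.prems(1)
    show ?thesis unfolding differentiable_def by blast
  qed
  moreover have "C_k_on n U (dir_deriv g v)" for v
    using Suc.IH[of "dir_deriv f v" "dir_deriv g v"] Suc.prems dir_deriv_local[OF \<open>open U\<close>, of _ f g v]
    by auto
  ultimately show ?case by simp
qed

lemma C_k_on_subset: "C_k_on n U f \<Longrightarrow> V \<subseteq> U \<Longrightarrow> C_k_on n V f"
  by (induction n arbitrary: f) (auto intro: continuous_on_subset)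

lemma C_k_on_Suc_D: "C_k_on (Suc n) U f \<Longrightarrow> C_k_on n U f"
proof (induction n arbitrary: f)
  case 0
  then show ?case
    by (auto intro!: continuous_at_imp_continuous_on differentiable_imp_continuous_within)
next
  case (Suc n)
  then show ?case by simp
qed

lemma C_k_on_open_cover:
  assumes "\<And>x. x \<in> U \<Longrightarrow> \<exists>V. open V \<and> x \<in> V \<and> C_k_on n V f"
  shows "C_k_on n U f"
  using assms
proof (induction n arbitrary: f)
  case 0
  have "isCont f x" if "x \<in> U" for x
    using 0[OF that] by (auto simp: continuous_on_eq_continuous_at)
  then show ?case
    by (simp add: continuous_at_imp_continuous_on)
next
  case (Suc n)
  have "f differentiable (at x)" if "x \<in> U" for x
    using Suc.prems[OF that] by auto
  moreover have "C_k_on n U (dir_deriv f v)" for v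
  proof (rule Suc.IH)
    fix x assume "x \<in> U"
    from Suc.prems[OF this] show "\<exists>V. open V \<and> x \<in> V \<and> C_k_on n V (dir_deriv f v)"
      by auto
  qed
  ultimately show ?case by simp
qed

lemma C_k_on_const: "C_k_on n (U :: 'a::euclidean_space set) (\<lambda>x. c)"
proof (induction n arbitrary: c)
  case (Suc n)
  have "dir_deriv (\<lambda>x. c) v = (\<lambda>x. 0)" for v :: 'a
    by (rule ext, rule dir_deriv_eq) simp
  then show ?case using Suc by simp
qed simp

lemma C_k_on_linear:
  assumes "open U" "bounded_linear h" "C_k_on n U f"
  shows "C_k_on n U (\<lambda>x. h (f x))"
  using assms(3)
proof (induction n arbitrary: f)
  case 0
  then show ?case
    using assms(2) by (auto intro: bounded_linear.continuous_on)
next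
  case (Suc n)
  have D: "((\<lambda>x. h (f x)) has_derivative (\<lambda>v. h (dir_deriv f v q))) (at q)" if "q \<in> U" for q
    using Suc.prems that
    by (auto intro!: bounded_linear.has_derivative[OF assms(2)] has_derivative_dir_deriv)
  have "C_k_on n U (dir_deriv (\<lambda>x. h (f x)) v)" for v
  proof (rule C_k_on_cong[OF \<open>open U\<close>])
    show "C_k_on n U (\<lambda>q. h (dir_deriv f v q))"
      using Suc by simp
    show "\<And>x. x \<in> U \<Longrightarrow> h (dir_deriv f v x) = dir_deriv (\<lambda>x. h (f x)) v x"
      using dir_deriv_eq[OF D] by simp
  qed
  then show ?case
    using D by (auto simp: differentiable_def)
qed

lemma C_k_on_id: "C_k_on n U (\<lambda>x. x)"
proof (cases n)
  case (Suc m)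
  have "dir_deriv (\<lambda>x. x) v = (\<lambda>x. v)" for v :: 'a
    by (rule ext, rule dir_deriv_eq) simp
  then show ?thesis using Suc by (simp add: C_k_on_const)
qed simp

lemma C_k_on_add:
  assumes "open U" "C_k_on n U f" "C_k_on n U g"
  shows "C_k_on n U (\<lambda>x. f x + g x)"
  using assms(2,3)
proof (induction n arbitrary: f g)
  case 0
  then show ?case by (auto intro: continuous_intros)
next
  case (Suc n)
  have D: "((\<lambda>x. f x + g x) has_derivative (\<lambda>v. dir_deriv f v q + dir_deriv g v q)) (at q)"
    if "q \<in> U" for q
    using Suc.prems that by (auto intro!: has_derivative_add has_derivative_dir_deriv)
  have "C_k_on n U (dir_deriv (\<lambda>x. f x + g x) v)" for v
  proof (rule C_k_on_cong[OF \<open>open U\<close>])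
    show "C_k_on n U (\<lambda>q. dir_deriv f v q + dir_deriv g v q)"
      using Suc by simp
    show "\<And>x. x \<in> U \<Longrightarrow> dir_deriv f v x + dir_deriv g v x = dir_deriv (\<lambda>x. f x + g x) v x"
      using dir_deriv_eq[OF D] by simp
  qed
  then show ?case
    using D by (auto simp: differentiable_def)
qed

text \<open>The product rule pairs each factor with the derivative of the other, so the induction
  varies both; \<open>C_k_on_Suc_D\<close> lowers the order of the undifferentiated factor.\<close>

lemma C_k_on_bilinear:
  assumes "open U" "bounded_bilinear h" "C_k_on n U f" "C_k_on n U g"
  shows "C_k_on n U (\<lambda>x. h (f x) (g x))"
  using assms(3,4)
proof (induction n arbitrary: f g)
  case 0
  then show ?case using assms(2) by (auto intro: bounded_bilinear.continuous_on)
next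
  case (Suc n)
  have D: "((\<lambda>x. h (f x) (g x)) has_derivative
      (\<lambda>v. h (f q) (dir_deriv g v q) + h (dir_deriv f v q) (g q))) (at q)"
    if "q \<in> U" for q
    using Suc.prems that
    by (auto intro!: bounded_bilinear.FDERIV[OF assms(2)] has_derivative_dir_deriv)
  have "C_k_on n U (dir_deriv (\<lambda>x. h (f x) (g x)) v)" for v
  proof (rule C_k_on_cong[OF \<open>open U\<close>])
    have "C_k_on n U f" "C_k_on n U g"
      using Suc.prems C_k_on_Suc_D by blast+
    then show "C_k_on n U (\<lambda>q. h (f q) (dir_deriv g v q) + h (dir_deriv f v q) (g q))"
      using Suc by (auto intro!: C_k_on_add \<open>open U\<close>)
    show "\<And>x. x \<in> U \<Longrightarrow> h (f x) (dir_deriv g v x) + h (dir_deriv f v x) (g x)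
        = dir_deriv (\<lambda>x. h (f x) (g x)) v x"
      using dir_deriv_eq[OF D] by simp
  qed
  then show ?case
    using D by (auto simp: differentiable_def)
qed

lemma C_k_on_sum:
  assumes "open U" "\<And>i. i \<in> I \<Longrightarrow> C_k_on n U (f i)"
  shows "C_k_on n U (\<lambda>x. \<Sum>i\<in>I. f i x)"
  using assms(2)
  by (induction I rule: infinite_finite_induct) (auto intro: C_k_on_const C_k_on_add[OF \<open>open U\<close>])

lemma dir_deriv_compose:
  assumes "g differentiable (at q)" "f differentiable (at (g q))"
  shows "((\<lambda>x. f (g x)) has_derivative (\<lambda>v. dir_deriv f (dir_deriv g v q) (g q))) (at q)"
  using has_derivative_compose[OF has_derivative_dir_deriv[OF assms(1)] has_derivative_dir_deriv[OF assms(2)]] .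

lemma linear_sum_Basis:
  assumes "linear h"
  shows "h v = (\<Sum>b\<in>Basis. (v \<bullet> b) *\<^sub>R h b)"
proof -
  have "h v = h (\<Sum>b\<in>Basis. (v \<bullet> b) *\<^sub>R b)"
    by (simp add: euclidean_representation)
  also have "\<dots> = (\<Sum>b\<in>Basis. (v \<bullet> b) *\<^sub>R h b)"
    by (simp add: linear_sum[OF assms] linear_cmul[OF assms])
  finally show ?thesis .
qed

text \<open>\<open>C_k_on\<close> knows derivatives only in fixed directions, whereas the chain rule
  produces the direction \<open>dir_deriv g v q\<close>, which moves with \<open>q\<close>.
  Expanding it in \<open>Basis\<close> leaves fixed directions with varying coefficients.\<close>

lemma C_k_on_compose:
  assumes "open U" "open V" "C_k_on n V f" "C_k_on n U g" "g ` U \<subseteq> V"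
  shows "C_k_on n U (\<lambda>x. f (g x))"
  using assms(3,4)
proof (induction n arbitrary: f)
  case 0
  then show ?case using assms(5) by (auto intro: continuous_on_compose2)
next
  case (Suc n)
  have D: "((\<lambda>x. f (g x)) has_derivative (\<lambda>v. dir_deriv f (dir_deriv g v q) (g q))) (at q)"
    if "q \<in> U" for q
    using Suc.prems that assms(5) by (intro dir_deriv_compose) auto
  have "C_k_on n U (dir_deriv (\<lambda>x. f (g x)) v)" for v
  proof (rule C_k_on_cong[OF \<open>open U\<close>])
    show "C_k_on n U (\<lambda>q. \<Sum>b\<in>Basis. (dir_deriv g v q \<bullet> b) *\<^sub>R dir_deriv f b (g q))"
    proof (intro C_k_on_sum C_k_on_bilinear[OF _ bounded_bilinear_scaleR] assms(1)
          C_k_on_linear[OF _ bounded_linear_inner_left] Suc.IH C_k_on_Suc_D[OF Suc.prems(2)])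
      show "C_k_on n U (dir_deriv g v)" "C_k_on n V (dir_deriv f b)" for b
        using Suc.prems by simp_all
    qed
    fix q assume "q \<in> U"
    then have "f differentiable (at (g q))"
      using Suc.prems assms(5) by auto
    from linear_sum_Basis[OF linear_dir_deriv[OF this]]
    show "(\<Sum>b\<in>Basis. (dir_deriv g v q \<bullet> b) *\<^sub>R dir_deriv f b (g q))
        = dir_deriv (\<lambda>x. f (g x)) v q"
      using dir_deriv_eq[OF D[OF \<open>q \<in> U\<close>]] by metis
  qed
  then show ?case
    using D by (auto simp: differentiable_def)
qed

text \<open>The exponent is arbitrary because each derivative lowers it by one. The exponent -1/2
  serves to normalise gradients.\<close>

lemma C_k_on_powr: "C_k_on n {0::real<..} (\<lambda>x. x powr a)"
proof (induction n arbitrary: a)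
  case 0
  then show ?case by (auto intro!: continuous_intros)
next
  case (Suc n)
  have D: "((\<lambda>x. x powr a) has_derivative (\<lambda>v. v * (a * x powr (a - 1)))) (at x)" if "x > 0" for x
    using has_real_derivative_powr[OF that, of a]
    unfolding has_field_derivative_def by (rule has_derivative_eq_rhs) (auto simp: fun_eq_iff)
  have "C_k_on n {0<..} (dir_deriv (\<lambda>x. x powr a) v)" for v
  proof (rule C_k_on_cong)
    show "C_k_on n {0<..} (\<lambda>x. v * (a * x powr (a - 1)))"
      by (intro C_k_on_linear[OF _ bounded_linear_mult_right] Suc) auto
    show "\<And>x. x \<in> {0<..} \<Longrightarrow> v * (a * x powr (a - 1)) = dir_deriv (\<lambda>x. x powr a) v x"
      using dir_deriv_eq[OF D] by simp
  qed auto
  then show ?case using D by (auto simp: differentiable_def)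
qed

section \<open>Closure properties of smooth functions\<close>

lemma smooth_on_D: "smooth_on U f \<Longrightarrow> C_k_on n U f"
  by (simp add: smooth_on_def)

lemma smooth_on_dir_deriv: "smooth_on U f \<Longrightarrow> smooth_on U (dir_deriv f v)"
  unfolding smooth_on_def by (metis C_k_on.simps(2))

lemma smooth_on_differentiable: "smooth_on U f \<Longrightarrow> q \<in> U \<Longrightarrow> f differentiable (at q)"
  unfolding smooth_on_def by (metis C_k_on.simps(2))

lemma smooth_on_continuous_on: "smooth_on U f \<Longrightarrow> continuous_on U f"
  unfolding smooth_on_def by (metis C_k_on.simps(1))

lemma smooth_on_has_derivative:
  "smooth_on U f \<Longrightarrow> q \<in> U \<Longrightarrow> (f has_derivative (\<lambda>v. dir_deriv f v q)) (at q)"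
  by (simp add: has_derivative_dir_deriv smooth_on_differentiable)

lemma smooth_on_subset: "smooth_on U f \<Longrightarrow> V \<subseteq> U \<Longrightarrow> smooth_on V f"
  unfolding smooth_on_def using C_k_on_subset by blast

lemma smooth_on_cong:
  "open U \<Longrightarrow> (\<And>x. x \<in> U \<Longrightarrow> f x = g x) \<Longrightarrow> smooth_on U f \<Longrightarrow> smooth_on U g"
  unfolding smooth_on_def using C_k_on_cong by blast

lemma smooth_on_open_cover:
  "(\<And>x. x \<in> U \<Longrightarrow> \<exists>V. open V \<and> x \<in> V \<and> smooth_on V f) \<Longrightarrow> smooth_on U f"
  unfolding smooth_on_def using C_k_on_open_cover by meson

lemma smooth_on_const: "smooth_on U (\<lambda>x. c)"
  by (simp add: smooth_on_def C_k_on_const)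

lemma smooth_on_id: "smooth_on U (\<lambda>x. x)"
  by (simp add: smooth_on_def C_k_on_id)

lemma smooth_on_linear:
  "open U \<Longrightarrow> bounded_linear h \<Longrightarrow> smooth_on U f \<Longrightarrow> smooth_on U (\<lambda>x. h (f x))"
  by (simp add: smooth_on_def C_k_on_linear)

lemma smooth_on_add:
  "open U \<Longrightarrow> smooth_on U f \<Longrightarrow> smooth_on U g \<Longrightarrow> smooth_on U (\<lambda>x. f x + g x)"
  by (simp add: smooth_on_def C_k_on_add)

lemma smooth_on_bilinear:
  "open U \<Longrightarrow> bounded_bilinear h \<Longrightarrow> smooth_on U f \<Longrightarrow> smooth_on U g \<Longrightarrow> smooth_on U (\<lambda>x. h (f x) (g x))"
  by (simp add: smooth_on_def C_k_on_bilinear)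

lemmas smooth_on_scaleR = smooth_on_bilinear[OF _ bounded_bilinear_scaleR]
lemmas smooth_on_inner = smooth_on_bilinear[OF _ bounded_bilinear_inner]
lemmas smooth_on_mult = smooth_on_bilinear[OF _ bounded_bilinear_mult]

lemma smooth_on_sum:
  "open U \<Longrightarrow> (\<And>i. i \<in> I \<Longrightarrow> smooth_on U (f i)) \<Longrightarrow> smooth_on U (\<lambda>x. \<Sum>i\<in>I. f i x)"
  by (simp add: smooth_on_def C_k_on_sum)

lemma smooth_on_compose:
  "open U \<Longrightarrow> open V \<Longrightarrow> smooth_on V f \<Longrightarrow> smooth_on U g \<Longrightarrow> g ` U \<subseteq> V \<Longrightarrow> smooth_on U (\<lambda>x. f (g x))"
  unfolding smooth_on_def using C_k_on_compose by blast

lemma smooth_on_powr: "smooth_on {0::real<..} (\<lambda>x. x powr a)"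
  by (simp add: smooth_on_def C_k_on_powr)

lemma smooth_on_Pair:
  assumes "open U" "smooth_on U f" "smooth_on U g"
  shows "smooth_on U (\<lambda>x. (f x, g x))"
proof -
  have "smooth_on U (\<lambda>x. (f x, 0) + (0, g x))"
    by (intro smooth_on_add smooth_on_linear[where h = "\<lambda>y. (y, 0)"]
        smooth_on_linear[where h = "\<lambda>y. (0, y)"] assms
        bounded_linear_Pair bounded_linear_ident bounded_linear_zero)
  then show ?thesis by simp
qed

section \<open>Gradient, Hessian and Levi form\<close>

lemma mvt_segment:
  fixes f :: "'a::euclidean_space \<Rightarrow> real"
  assumes "h > 0" "\<And>s. s \<in> {0..h} \<Longrightarrow> f differentiable (at (a + s *\<^sub>R u))"
  shows "\<exists>s\<in>{0<..<h}. f (a + h *\<^sub>R u) - f a = h * dir_deriv f u (a + s *\<^sub>R u)"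
proof -
  have D: "((\<lambda>s. f (a + s *\<^sub>R u)) has_derivative (\<lambda>t. t * dir_deriv f u (a + s *\<^sub>R u))) (at s)"
    if "s \<in> {0..h}" for s
  proof -
    have "((\<lambda>s. a + s *\<^sub>R u) has_derivative (\<lambda>t. t *\<^sub>R u)) (at s)"
      by (auto intro!: derivative_eq_intros)
    from has_derivative_compose[OF this has_derivative_dir_deriv[OF assms(2)[OF that]]]
    show ?thesis
      using linear_cmul[OF linear_dir_deriv[OF assms(2)[OF that]]] by simp
  qed
  have "\<exists>s\<in>{0<..<h}. f (a + h *\<^sub>R u) - f (a + 0 *\<^sub>R u) = (h - 0) * dir_deriv f u (a + s *\<^sub>R u)"
    using mvt_simple[OF \<open>h > 0\<close>, of "\<lambda>s. f (a + s *\<^sub>R u)" "\<lambda>s t. t * dir_deriv f u (a + s *\<^sub>R u)"]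
      has_derivative_at_withinI[OF D] by auto
  then show ?thesis by simp
qed

text \<open>The mean value theorem is applied twice: to the increment \<open>F\<close> in direction
  \<open>v\<close>, then to \<open>dir_deriv f v\<close> in direction \<open>w\<close>. The second
  difference is symmetric in \<open>v\<close> and \<open>w\<close>, which is the source of
  \<open>dir_deriv_commute\<close>.\<close>

lemma second_difference:
  fixes f :: "'a::euclidean_space \<Rightarrow> real"
  assumes sm: "smooth_on U f" and "open U" and "h > 0" and sub: "ball x r \<subseteq> U"
    and h: "h * (norm v + norm w) < r"
  shows "\<exists>y\<in>ball x r. f (x + h *\<^sub>R v + h *\<^sub>R w) - f (x + h *\<^sub>R v) - f (x + h *\<^sub>R w) + f x
      = h\<^sup>2 * dir_deriv (dir_deriv f v) w y"
proof -
  have in_ball: "x + s *\<^sub>R v + t *\<^sub>R w \<in> ball x r" if "s \<in> {0..h}" "t \<in> {0..h}" for s t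
  proof -
    have "norm (s *\<^sub>R v + t *\<^sub>R w) \<le> norm (s *\<^sub>R v) + norm (t *\<^sub>R w)"
      by (rule norm_triangle_ineq)
    also have "\<dots> \<le> h * norm v + h * norm w"
      using that by (auto intro!: add_mono mult_right_mono)
    finally show ?thesis
      using h norm_minus_cancel[of "s *\<^sub>R v + t *\<^sub>R w"] by (simp add: dist_norm algebra_simps)
  qed
  define F where "F = (\<lambda>z. f (z + h *\<^sub>R w) - f z)"
  have F: "(F has_derivative (\<lambda>u. dir_deriv f u (z + h *\<^sub>R w) - dir_deriv f u z)) (at z)"
    if "z \<in> U" "z + h *\<^sub>R w \<in> U" for z
  proof -
    have "((\<lambda>z. z + h *\<^sub>R w) has_derivative (\<lambda>u. u)) (at z)"
      by (auto intro!: derivative_eq_intros)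
    from has_derivative_compose[OF this smooth_on_has_derivative[OF sm that(2)]]
    show ?thesis unfolding F_def
      by (rule has_derivative_diff) (rule smooth_on_has_derivative[OF sm that(1)])
  qed
  have U: "x + s *\<^sub>R v \<in> U" "x + s *\<^sub>R v + h *\<^sub>R w \<in> U" if "s \<in> {0..h}" for s
    using in_ball[of s 0] in_ball[of s h] that \<open>h > 0\<close> sub by auto
  obtain s where s: "s \<in> {0<..<h}" "F (x + h *\<^sub>R v) - F x = h * dir_deriv F v (x + s *\<^sub>R v)"
    using mvt_segment[OF \<open>h > 0\<close>, of F x v] F[OF U] unfolding differentiable_def by blast
  have Fs: "dir_deriv F v (x + s *\<^sub>R v)
      = dir_deriv f v (x + s *\<^sub>R v + h *\<^sub>R w) - dir_deriv f v (x + s *\<^sub>R v)"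
    using s U by (intro dir_deriv_eq F) auto
  have "dir_deriv f v differentiable (at (x + s *\<^sub>R v + t *\<^sub>R w))" if "t \<in> {0..h}" for t
    using in_ball[of s t] that s sub by (intro smooth_on_differentiable[OF smooth_on_dir_deriv[OF sm]]) auto
  then obtain t where t: "t \<in> {0<..<h}"
     "dir_deriv f v (x + s *\<^sub>R v + h *\<^sub>R w) - dir_deriv f v (x + s *\<^sub>R v)
        = h * dir_deriv (dir_deriv f v) w (x + s *\<^sub>R v + t *\<^sub>R w)"
    using mvt_segment[OF \<open>h > 0\<close>, of "dir_deriv f v" "x + s *\<^sub>R v" w] by blast
  show ?thesis
  proof (rule bexI)
    show "x + s *\<^sub>R v + t *\<^sub>R w \<in> ball x r"
      using in_ball s t by auto
    show "f (x + h *\<^sub>R v + h *\<^sub>R w) - f (x + h *\<^sub>R v) - f (x + h *\<^sub>R w) + f x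
      = h\<^sup>2 * dir_deriv (dir_deriv f v) w (x + s *\<^sub>R v + t *\<^sub>R w)"
      using s(2) Fs t(2) by (simp add: F_def power2_eq_square)
  qed
qed

lemma dir_deriv_commute:
  fixes f :: "'a::euclidean_space \<Rightarrow> real"
  assumes "open U" "smooth_on U f" "x \<in> U"
  shows "dir_deriv (dir_deriv f v) w x = dir_deriv (dir_deriv f w) v x"
proof -
  let ?A = "dir_deriv (dir_deriv f v) w" and ?B = "dir_deriv (dir_deriv f w) v"
  have cont: "isCont ?A x" "isCont ?B x"
    using assms smooth_on_continuous_on[OF smooth_on_dir_deriv[OF smooth_on_dir_deriv[OF assms(2)]]]
    by (auto simp: continuous_on_eq_continuous_at)
  have "dist (?A x) (?B x) \<le> e" if "e > 0" for e
  proof -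
    from cont \<open>e > 0\<close> obtain r1 r2 where
      r1: "r1 > 0" "\<And>y. dist y x < r1 \<Longrightarrow> dist (?A y) (?A x) < e / 2" and
      r2: "r2 > 0" "\<And>y. dist y x < r2 \<Longrightarrow> dist (?B y) (?B x) < e / 2"
      unfolding continuous_at_eps_delta by (metis half_gt_zero)
    from assms obtain r3 where r3: "r3 > 0" "ball x r3 \<subseteq> U"
      using open_contains_ball by blast
    define r where "r = min r1 (min r2 r3)"
    have r: "r > 0" "ball x r \<subseteq> U"
      using r1 r2 r3 by (auto simp: r_def)
    \<comment> \<open>The summand 1 keeps the denominator positive even if both directions
      vanish.\<close>
    define h where "h = r / (2 * (norm v + norm w + 1))"
    have "h > 0"
      using r by (simp add: h_def add_nonneg_pos)
    have "h * (norm v + norm w) < r"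
    proof -
      have "norm v + norm w < 2 * (norm v + norm w + 1)"
        by (smt (verit) norm_ge_zero)
      then show ?thesis
        using r by (simp add: h_def divide_simps add_nonneg_pos)
    qed
    from second_difference[OF assms(2,1) \<open>h > 0\<close> r(2) this]
      second_difference[OF assms(2,1) \<open>h > 0\<close> r(2), of w v] this
    obtain y z where "y \<in> ball x r" "z \<in> ball x r" "h\<^sup>2 * ?A y = h\<^sup>2 * ?B z"
      by (smt (verit) add.commute add.left_commute)
    then have "?A y = ?B z" "dist y x < r1" "dist z x < r2"
      using \<open>h > 0\<close> by (auto simp: r_def dist_commute)
    then show ?thesis
      using r1(2)[of y] r2(2)[of z] unfolding dist_real_def by linarith
  qed
  then have "dist (?A x) (?B x) \<le> 0"
    by (rule field_le_epsilon) simp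
  then show ?thesis by simp
qed

text \<open>With the derivative represented by a vector, the Hessian becomes the linear map
  \<open>dir_deriv (grad f)\<close>; the later relations between Hessians at different points are
  identities of such maps.\<close>

definition grad :: "('a::euclidean_space \<Rightarrow> real) \<Rightarrow> 'a \<Rightarrow> 'a"
  where "grad f q = (\<Sum>b\<in>Basis. dir_deriv f b q *\<^sub>R b)"

lemma dir_deriv_eq_grad:
  assumes "f differentiable (at q)"
  shows "dir_deriv f v q = grad f q \<bullet> v"
  using linear_sum_Basis[OF linear_dir_deriv[OF assms], of v]
  by (simp add: grad_def inner_sum_right inner_commute[of _ v] mult.commute)

lemma grad_eqI:
  assumes "(f has_derivative (\<lambda>v. g \<bullet> v)) (at q)"
  shows "grad f q = g"
  unfolding grad_def dir_deriv_eq[OF assms] by (rule euclidean_representation)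

lemma has_derivative_grad:
  "f differentiable (at q) \<Longrightarrow> (f has_derivative (\<lambda>v. grad f q \<bullet> v)) (at q)"
  using has_derivative_dir_deriv[of f q] by (simp add: dir_deriv_eq_grad)

lemma grad_local:
  "open U \<Longrightarrow> q \<in> U \<Longrightarrow> (\<And>x. x \<in> U \<Longrightarrow> f x = g x) \<Longrightarrow> grad f q = grad g q"
  unfolding grad_def using dir_deriv_local[of U q f g] by simp

lemma smooth_on_grad: "open U \<Longrightarrow> smooth_on U f \<Longrightarrow> smooth_on U (grad f)"
  unfolding grad_def[abs_def]
  by (intro smooth_on_sum smooth_on_scaleR smooth_on_dir_deriv smooth_on_const)

lemma dir_deriv_grad_inner:
  assumes "open U" "smooth_on U f" "q \<in> U"
  shows "dir_deriv (grad f) v q \<bullet> w = dir_deriv (dir_deriv f w) v q"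
proof -
  have "((\<lambda>x. grad f x \<bullet> w) has_derivative (\<lambda>v. dir_deriv (grad f) v q \<bullet> w)) (at q)"
    by (intro has_derivative_inner_left smooth_on_has_derivative[OF smooth_on_grad[OF assms(1,2)] assms(3)])
  then have "dir_deriv (grad f) v q \<bullet> w = dir_deriv (\<lambda>x. grad f x \<bullet> w) v q"
    by (simp add: dir_deriv_eq)
  also have "\<dots> = dir_deriv (dir_deriv f w) v q"
    by (rule dir_deriv_local[OF assms(1,3)])
      (simp add: dir_deriv_eq_grad smooth_on_differentiable[OF assms(2)])
  finally show ?thesis .
qed

lemma dir_deriv_grad_sym:
  assumes "open U" "smooth_on U f" "q \<in> U"
  shows "dir_deriv (grad f) v q \<bullet> w = v \<bullet> dir_deriv (grad f) w q"
  by (metis assms dir_deriv_commute dir_deriv_grad_inner inner_commute)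

lemma linear_dir_deriv_grad:
  "open U \<Longrightarrow> smooth_on U f \<Longrightarrow> q \<in> U \<Longrightarrow> linear (\<lambda>v. dir_deriv (grad f) v q)"
  using linear_dir_deriv smooth_on_differentiable smooth_on_grad by blast

lemma real_hessian_eq:
  assumes "open U" "smooth_on U f" "q \<in> U"
  shows "real_hessian f q V W = dir_deriv (grad f) V q \<bullet> W"
proof -
  have "real_hessian f q V W
      = (\<Sum>b\<in>Basis. \<Sum>c\<in>Basis. (dir_deriv (grad f) b q \<bullet> c) * (V \<bullet> b) * (W \<bullet> c))"
    unfolding real_hessian_def dir_deriv_grad_inner[OF assms] ..
  also have "\<dots> = (\<Sum>b\<in>Basis. (V \<bullet> b) * (dir_deriv (grad f) b q \<bullet> W))"
  proof (rule sum.cong[OF refl])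
    fix b :: C2
    show "(\<Sum>c\<in>Basis. (dir_deriv (grad f) b q \<bullet> c) * (V \<bullet> b) * (W \<bullet> c))
        = (V \<bullet> b) * (dir_deriv (grad f) b q \<bullet> W)"
      unfolding euclidean_inner[of "dir_deriv (grad f) b q" W] sum_distrib_left
      by (simp add: mult_ac)
  qed
  also have "\<dots> = dir_deriv (grad f) V q \<bullet> W"
    using linear_sum_Basis[OF linear_dir_deriv_grad[OF assms], of V]
    by (simp add: inner_sum_left)
  finally show ?thesis .
qed

text \<open>This is the complex Hessian on the diagonal without its factor 1/4, in the form in which
  estimates for the real Hessian carry over term by term.\<close>

definition levi :: "(C2 \<Rightarrow> real) \<Rightarrow> C2 \<Rightarrow> C2 \<Rightarrow> real"
  where "levi f q a = dir_deriv (grad f) a q \<bullet> a + dir_deriv (grad f) (\<i> *s a) q \<bullet> (\<i> *s a)"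

lemma C2_eq_axes:
  fixes A :: C2
  shows "A = Re (A $ 1) *\<^sub>R axis 1 1 + Im (A $ 1) *\<^sub>R axis 1 \<i> + Re (A $ 2) *\<^sub>R axis 2 1 + Im (A $ 2) *\<^sub>R axis 2 \<i>"
    "\<i> *s A = Re (A $ 1) *\<^sub>R axis 1 \<i> - Im (A $ 1) *\<^sub>R axis 1 1 + Re (A $ 2) *\<^sub>R axis 2 \<i> - Im (A $ 2) *\<^sub>R axis 2 1"
  by (auto simp: vec_eq_iff axis_def complex_eq_iff forall_2)

lemma complex_hessian_eq_levi:
  assumes "open U" "smooth_on U f" "q \<in> U"
  shows "complex_hessian f q A A = complex_of_real (levi f q A / 4)"
proof -
  define B where "B v w = dir_deriv (dir_deriv f w) v q" for v w
  have Bg: "B v w = dir_deriv (grad f) v q \<bullet> w" for v w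
    by (simp add: B_def dir_deriv_grad_inner[OF assms])
  note lin = linear_dir_deriv_grad[OF assms]
  have cplx: "dir_deriv (cplx f) v y = of_real (dir_deriv f v y)" if "y \<in> U" for v y
    using smooth_on_has_derivative[OF assms(2) that]
    by (intro dir_deriv_eq has_derivative_of_real)
  have dd: "dir_deriv (dzbar k (cplx f)) v q = (of_real (B v (axis k 1)) + \<i> * of_real (B v (axis k \<i>))) / 2" for k v
  proof -
    have "dir_deriv (dzbar k (cplx f)) v q
        = dir_deriv (\<lambda>y. (of_real (dir_deriv f (axis k 1) y) + \<i> * of_real (dir_deriv f (axis k \<i>) y)) / 2) v q"
      by (rule dir_deriv_local[OF assms(1,3)]) (simp add: dzbar_def cplx)
    also have "\<dots> = (of_real (B v (axis k 1)) + \<i> * of_real (B v (axis k \<i>))) / 2"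
      unfolding B_def
      by (intro dir_deriv_eq bounded_linear.has_derivative[OF bounded_linear_divide] has_derivative_add
          has_derivative_mult_right has_derivative_of_real
          smooth_on_has_derivative[OF smooth_on_dir_deriv[OF assms(2)] assms(3)])
    finally show ?thesis .
  qed
  \<comment> \<open>Symmetry of second derivatives is what removes the imaginary part of the sum;
    each of the six mixed pairs keeps a single order.\<close>
  have sym: "B (axis 1 \<i>) (axis 1 1) = B (axis 1 1) (axis 1 \<i>)"
    "B (axis 2 \<i>) (axis 2 1) = B (axis 2 1) (axis 2 \<i>)"
    "B (axis 2 1) (axis 1 1) = B (axis 1 1) (axis 2 1)"
    "B (axis 2 \<i>) (axis 1 1) = B (axis 1 1) (axis 2 \<i>)"
    "B (axis 2 1) (axis 1 \<i>) = B (axis 1 \<i>) (axis 2 1)"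
    "B (axis 2 \<i>) (axis 1 \<i>) = B (axis 1 \<i>) (axis 2 \<i>)"
    unfolding B_def using dir_deriv_commute[OF assms] by blast+
  have levi: "levi f q A = B A A + B (\<i> *s A) (\<i> *s A)"
    by (simp add: levi_def Bg)
  have Badd: "B (v + v') w = B v w + B v' w" "B (v - v') w = B v w - B v' w" "B (c *\<^sub>R v) w = c * B v w"
    "B v (w + w') = B v w + B v w'" "B v (w - w') = B v w - B v w'" "B v (c *\<^sub>R w) = c * B v w"
    for v v' w w' c
    unfolding Bg by (simp_all add: linear_add[OF lin] linear_diff[OF lin] linear_cmul[OF lin]
        inner_left_distrib inner_right_distrib inner_diff_left inner_diff_right)
  \<comment> \<open>The coordinate expansion of \<open>A\<close> contains \<open>A\<close> itself,
    so rewriting with it would not terminate; here it is confined to \<open>B A A\<close>.\<close>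
  have BA: "B A A = (let A' = Re (A $ 1) *\<^sub>R axis 1 1 + Im (A $ 1) *\<^sub>R axis 1 \<i>
      + Re (A $ 2) *\<^sub>R axis 2 1 + Im (A $ 2) *\<^sub>R axis 2 \<i> in B A' A')"
    by (simp add: Let_def flip: C2_eq_axes(1))
  have "4 * complex_hessian f q A A = of_real (levi f q A)"
    unfolding levi C2_eq_axes(2) BA Let_def complex_hessian_def dz_def dd sum_2 Badd sym
    by (simp add: complex_eq_iff) (simp add: field_simps)
  then show ?thesis by (simp add: mult.commute)
qed

section \<open>The smooth inverse function theorem\<close>

lemma smooth_on_local_inverse_C1:
  fixes f :: "'a::euclidean_space \<Rightarrow> 'a"
  assumes "open U" "smooth_on U f" "x0 \<in> U" "inj (\<lambda>v. dir_deriv f v x0)"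
  obtains U' V g where "open U'" "U' \<subseteq> U" "x0 \<in> U'" "open V" "f x0 \<in> V" "homeomorphism U' V f g"
    "\<And>y. y \<in> V \<Longrightarrow> (g has_derivative inv (\<lambda>v. dir_deriv f v (g y))) (at y)"
    "\<And>y. y \<in> V \<Longrightarrow> bij (\<lambda>v. dir_deriv f v (g y))"
proof -
  define f' where "f' = (\<lambda>x. Blinfun (\<lambda>v. dir_deriv f v x))"
  have f': "blinfun_apply (f' x) = (\<lambda>v. dir_deriv f v x)" if "x \<in> U" for x
    unfolding f'_def
    using bounded_linear_Blinfun_apply[OF has_derivative_bounded_linear[OF smooth_on_has_derivative[OF assms(2) that]]] .
  have der: "(f has_derivative blinfun_apply (f' x)) (at x)" if "x \<in> U" for x
    using smooth_on_has_derivative[OF assms(2) that] f'[OF that] by simp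
  have cont: "continuous_on U f'"
  proof (rule continuous_on_blinfun_componentwise)
    fix i :: 'a
    have "continuous_on U (dir_deriv f i)"
      by (intro smooth_on_continuous_on smooth_on_dir_deriv assms)
    then show "continuous_on U (\<lambda>x. blinfun_apply (f' x) i)"
      by (rule continuous_on_eq) (simp add: f')
  qed
  have "linear (\<lambda>v. dir_deriv f v x0)"
    by (intro linear_dir_deriv smooth_on_differentiable[OF assms(2,3)])
  from linear_injective_left_inverse[OF this assms(4)]
  obtain h where h: "linear h" "h \<circ> (\<lambda>v. dir_deriv f v x0) = id" by blast
  have "Blinfun h o\<^sub>L f' x0 = id_blinfun"
    using h by (intro blinfun_eqI)
      (auto simp: f'[OF assms(3)] bounded_linear_Blinfun_apply linear_conv_bounded_linear fun_eq_iff)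
  from inverse_function_theorem[OF \<open>open U\<close> der cont \<open>x0 \<in> U\<close> this]
  obtain U' V g g' where *: "open U'" "U' \<subseteq> U" "x0 \<in> U'" "open V" "f x0 \<in> V" "homeomorphism U' V f g"
    "\<And>y. y \<in> V \<Longrightarrow> (g has_derivative g' y) (at y)"
    "\<And>y. y \<in> V \<Longrightarrow> g' y = inv (blinfun_apply (f' (g y)))"
    "\<And>y. y \<in> V \<Longrightarrow> bij (blinfun_apply (f' (g y)))"
    by metis
  have "blinfun_apply (f' (g y)) = (\<lambda>v. dir_deriv f v (g y))" if "y \<in> V" for y
    using homeomorphism_image2[OF *(6)] that *(2) by (intro f') auto
  then show ?thesis
    using * by (intro that[of U' V g]) auto
qed

lemma sum_Basis_apply:
  "linear A \<Longrightarrow> (\<Sum>b\<in>Basis. (u \<bullet> b) *\<^sub>R A b) = A u"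
  using linear_sum_Basis[of A u] by simp

section \<open>Inverses of smooth families of linear maps\<close>

context
  fixes S :: "'a::euclidean_space set" and A :: "'a \<Rightarrow> 'b::euclidean_space \<Rightarrow> 'b"
  assumes S: "open S" and lin: "\<And>x. x \<in> S \<Longrightarrow> linear (A x)" and inj: "\<And>x. x \<in> S \<Longrightarrow> inj (A x)"
    and sm: "\<And>u. smooth_on S (\<lambda>x. A x u)"
begin

lemma inv_linear_solve: "x \<in> S \<Longrightarrow> A x u = v \<longleftrightarrow> u = inv (A x) v"
  using inj[of x] lin[of x] linear_injective_imp_surjective[of "A x"]
  by (metis inv_f_f surj_f_inv_f)

lemma linear_inv: "x \<in> S \<Longrightarrow> linear (inv (A x))"
  using lin[of x] inj[of x]
  by (metis inj_linear_imp_inv_linear)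

text \<open>A local inverse of \<open>(x, u) \<mapsto> (x, A x u)\<close> has the second component \<open>inv (A x) u\<close>.\<close>

lemma inv_linear_differentiable:
  assumes "x0 \<in> S"
  shows "(\<lambda>x. inv (A x) v) differentiable (at x0)"
proof -
  \<comment> \<open>Only \<open>A x u\<close> with \<open>u\<close> fixed is known to be smooth.
    Expanding the second component over \<open>Basis\<close> makes it smooth in both variables
    jointly.\<close>
  define F where "F = (\<lambda>z :: 'a \<times> 'b. (fst z, \<Sum>b\<in>Basis. (snd z \<bullet> b) *\<^sub>R A (fst z) b))"
  define B0 where "B0 = inv (A x0) v"
  have open_S: "open (S \<times> (UNIV :: 'b set))"
    by (simp add: S open_Times)
  have AF: "smooth_on (S \<times> (UNIV :: 'b set)) (\<lambda>z. A (fst z) b)" for b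
    by (rule smooth_on_compose[OF open_S S sm[of b], where g = fst])
      (auto intro!: smooth_on_linear[OF open_S bounded_linear_fst smooth_on_id])
  have smF: "smooth_on (S \<times> UNIV) F"
    unfolding F_def
    by (intro smooth_on_Pair smooth_on_sum smooth_on_scaleR AF open_S smooth_on_id
        smooth_on_linear[OF open_S bounded_linear_fst]
        smooth_on_linear[OF open_S bounded_linear_compose[OF bounded_linear_inner_left bounded_linear_snd]])
  have x0: "(x0, B0) \<in> S \<times> UNIV"
    using assms by simp
  have DF: "dir_deriv F hk (x0, B0) =
      (fst hk, A x0 (snd hk) + (\<Sum>b\<in>Basis. (B0 \<bullet> b) *\<^sub>R dir_deriv (\<lambda>x. A x b) (fst hk) x0))" for hk
  proof -
    have A': "((\<lambda>z. A (fst z) b) has_derivative (\<lambda>hk. dir_deriv (\<lambda>x. A x b) (fst hk) x0)) (at (x0, B0))" for b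
      using has_derivative_compose[OF has_derivative_fst[OF has_derivative_ident]
          smooth_on_has_derivative[OF sm]] assms by fastforce
    have "dir_deriv F hk (x0, B0) = (fst hk, \<Sum>b\<in>Basis. (B0 \<bullet> b) *\<^sub>R dir_deriv (\<lambda>x. A x b) (fst hk) x0
        + (snd hk \<bullet> b) *\<^sub>R A x0 b)"
      unfolding F_def
      by (rule dir_deriv_eq) (auto intro!: derivative_eq_intros A')
    then show ?thesis
      using sum_Basis_apply[OF lin[OF assms], of "snd hk"] by (simp add: sum.distrib add.commute)
  qed
  \<comment> \<open>The derivative is block triangular, with the identity and \<open>A x0\<close> on
    the diagonal.\<close>
  have "inj (\<lambda>hk. dir_deriv F hk (x0, B0))"
  proof (subst linear_injective_0)
    show "linear (\<lambda>hk. dir_deriv F hk (x0, B0))"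
      by (intro linear_dir_deriv smooth_on_differentiable[OF smF x0])
    have "dir_deriv (\<lambda>x. A x b) 0 x0 = 0" for b
      by (intro linear_0 linear_dir_deriv smooth_on_differentiable[OF sm assms])
    moreover have "k = 0" if "A x0 k = 0" for k
      using that inj[OF assms] lin[OF assms] linear_injective_0 by blast
    ultimately show "\<forall>hk. dir_deriv F hk (x0, B0) = 0 \<longrightarrow> hk = 0"
      by (auto simp: DF zero_prod_def)
  qed
  from smooth_on_local_inverse_C1[OF open_S smF x0 this]
  obtain U' V G where UV: "open U'" "U' \<subseteq> S \<times> UNIV" "(x0, B0) \<in> U'" "open V" "F (x0, B0) \<in> V"
    "homeomorphism U' V F G"
    "\<And>y. y \<in> V \<Longrightarrow> (G has_derivative inv (\<lambda>v. dir_deriv F v (G y))) (at y)"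
    by metis
  have F_eq: "F (x, u) = (x, A x u)" if "x \<in> S" for x u
    using sum_Basis_apply[OF lin[OF that], of u] by (simp add: F_def)
  have Fx0: "F (x0, B0) = (x0, v)"
    using inv_linear_solve[OF assms, of B0 v] by (simp add: F_eq assms B0_def)
  define W where "W = S \<inter> (\<lambda>x. (x, v)) -` V"
  have W: "open W" "x0 \<in> W"
    unfolding W_def using S UV(4,5) assms Fx0
    by (auto intro!: open_Int continuous_open_vimage continuous_intros)
  have eq: "inv (A x) v = snd (G (x, v))" if "x \<in> W" for x
  proof -
    have V: "(x, v) \<in> V" and "x \<in> S" using that by (auto simp: W_def)
    have "F (G (x, v)) = (x, v)"
      using homeomorphism_apply2[OF UV(6) V] .
    moreover have "fst (G (x, v)) \<in> S"
      using homeomorphism_image2[OF UV(6)] V UV(2) by auto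
    ultimately have "fst (G (x, v)) = x \<and> A x (snd (G (x, v))) = v"
      using F_eq[of "fst (G (x, v))" "snd (G (x, v))"] by auto
    then show ?thesis
      using inv_linear_solve[OF \<open>x \<in> S\<close>] by metis
  qed
  have "(\<lambda>x. snd (G (x, v))) differentiable (at x0)"
  proof -
    have "(x0, v) \<in> V" using UV(5) Fx0 by simp
    from has_derivative_snd[OF has_derivative_compose[OF has_derivative_Pair[OF has_derivative_ident[of "at x0"]
      has_derivative_const] UV(7)[OF this]]]
    show ?thesis
      unfolding differentiable_def by blast
  qed
  then obtain D where "((\<lambda>x. snd (G (x, v))) has_derivative D) (at x0)"
    unfolding differentiable_def by blast
  from this W have "((\<lambda>x. inv (A x) v) has_derivative D) (at x0)"
    by (rule has_derivative_transform_within_open) (simp add: eq)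
  then show ?thesis
    unfolding differentiable_def by blast
qed

text \<open>Differentiating \<open>A x (inv (A x) v) = v\<close> gives the usual formula - A^-1 A'
  A^-1. In coordinates the right-hand side uses \<open>inv (A x)\<close> at fixed vectors and at
  \<open>v\<close> only, and this shape closes the induction for smoothness.\<close>

lemma dir_deriv_inv_linear:
  assumes "x \<in> S"
  shows "dir_deriv (\<lambda>x. inv (A x) v) w x
    = (\<Sum>b\<in>Basis. \<Sum>c\<in>Basis. - ((inv (A x) v \<bullet> b) * (dir_deriv (\<lambda>x. A x b) w x \<bullet> c)) *\<^sub>R inv (A x) c)"
proof -
  let ?B = "\<lambda>x. inv (A x) v"
  let ?r = "\<Sum>b\<in>Basis. (?B x \<bullet> b) *\<^sub>R dir_deriv (\<lambda>x. A x b) w x"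
  have "((\<lambda>x. \<Sum>b\<in>Basis. (?B x \<bullet> b) *\<^sub>R A x b) has_derivative
      (\<lambda>w. \<Sum>b\<in>Basis. (?B x \<bullet> b) *\<^sub>R dir_deriv (\<lambda>x. A x b) w x + (dir_deriv ?B w x \<bullet> b) *\<^sub>R A x b)) (at x)"
    by (intro has_derivative_sum has_derivative_scaleR has_derivative_inner_left
        has_derivative_dir_deriv inv_linear_differentiable smooth_on_differentiable[OF sm] assms)
  from dir_deriv_eq[OF this]
  have "?r + A x (dir_deriv ?B w x) = dir_deriv (\<lambda>x. \<Sum>b\<in>Basis. (?B x \<bullet> b) *\<^sub>R A x b) w x"
    using sum_Basis_apply[OF lin[OF assms]] by (simp add: sum.distrib)
  also have "\<dots> = dir_deriv (\<lambda>x. v) w x"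
    using sum_Basis_apply[OF lin] inv_linear_solve
    by (intro dir_deriv_local[OF S assms]) metis
  also have "\<dots> = 0"
    by (intro dir_deriv_eq) simp
  finally have "A x (dir_deriv ?B w x) = - ?r"
    by (simp add: eq_neg_iff_add_eq_0 add.commute)
  then have "dir_deriv ?B w x = inv (A x) (- ?r)"
    using inv_linear_solve[OF assms] by blast
  also have "\<dots> = (\<Sum>c\<in>Basis. (- ?r \<bullet> c) *\<^sub>R inv (A x) c)"
    by (rule linear_sum_Basis[OF linear_inv[OF assms]])
  also have "\<dots> = (\<Sum>c\<in>Basis. \<Sum>b\<in>Basis. - ((?B x \<bullet> b) * (dir_deriv (\<lambda>x. A x b) w x \<bullet> c)) *\<^sub>R inv (A x) c)"
    by (simp add: inner_sum_left scaleR_sum_left sum_negf)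
  also have "\<dots> = (\<Sum>b\<in>Basis. \<Sum>c\<in>Basis. - ((?B x \<bullet> b) * (dir_deriv (\<lambda>x. A x b) w x \<bullet> c)) *\<^sub>R inv (A x) c)"
    by (rule sum.swap)
  finally show ?thesis .
qed

lemma smooth_on_inv_linear: "smooth_on S (\<lambda>x. inv (A x) v)"
proof -
  have "C_k_on n S (\<lambda>x. inv (A x) v)" for n
  proof (induction n arbitrary: v)
    case 0
    show ?case
      using inv_linear_differentiable
      by (auto intro!: continuous_at_imp_continuous_on differentiable_imp_continuous_within)
  next
    case (Suc n)
    have "C_k_on n S (dir_deriv (\<lambda>x. inv (A x) v) w)" for w
    proof (rule C_k_on_cong[OF S])
      show "C_k_on n S (\<lambda>x. \<Sum>b\<in>Basis. \<Sum>c\<in>Basis.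
          - ((inv (A x) v \<bullet> b) * (dir_deriv (\<lambda>x. A x b) w x \<bullet> c)) *\<^sub>R inv (A x) c)"
        by (intro C_k_on_sum C_k_on_bilinear[OF _ bounded_bilinear_scaleR]
            C_k_on_linear[OF _ bounded_linear_minus[OF bounded_linear_ident]]
            C_k_on_bilinear[OF _ bounded_bilinear_mult] C_k_on_linear[OF _ bounded_linear_inner_left]
            S Suc smooth_on_D[OF smooth_on_dir_deriv[OF sm]])
    qed (simp add: dir_deriv_inv_linear)
    then show ?case
      by (simp add: inv_linear_differentiable)
  qed
  then show ?thesis by (simp add: smooth_on_def)
qed

end

text \<open>Bootstrapping: the derivative of \<open>g\<close> is the pointwise inverse of the
  derivative of \<open>f\<close>, evaluated along \<open>g\<close>. The inverse family is smooth, so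
  the composite has the order of \<open>g\<close>, and \<open>g\<close> gains one order at each
  step.\<close>

theorem smooth_on_local_inverse:
  fixes f :: "'a::euclidean_space \<Rightarrow> 'a"
  assumes "open U" "smooth_on U f" "x0 \<in> U" "inj (\<lambda>v. dir_deriv f v x0)"
  obtains U' V g where "open U'" "U' \<subseteq> U" "x0 \<in> U'" "open V" "f x0 \<in> V" "homeomorphism U' V f g"
    "smooth_on V g"
proof -
  obtain U' V g where *: "open U'" "U' \<subseteq> U" "x0 \<in> U'" "open V" "f x0 \<in> V" "homeomorphism U' V f g"
    "\<And>y. y \<in> V \<Longrightarrow> (g has_derivative inv (\<lambda>v. dir_deriv f v (g y))) (at y)"
    "\<And>y. y \<in> V \<Longrightarrow> bij (\<lambda>v. dir_deriv f v (g y))"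
    using smooth_on_local_inverse_C1[OF assms] by metis
  have gV: "g ` V = U'"
    using *(6) by (rule homeomorphism_image2)
  have smf: "smooth_on U' f"
    using assms(2) *(2) by (rule smooth_on_subset)
  have smB: "smooth_on U' (\<lambda>x. inv (\<lambda>v. dir_deriv f v x) v)" for v
    using *(8) gV
    by (intro smooth_on_inv_linear *(1) linear_dir_deriv smooth_on_differentiable[OF smf]
        smooth_on_dir_deriv[OF smf]) (auto simp: bij_is_inj)
  have "C_k_on n V g" for n
  proof (induction n)
    case 0
    show ?case
      using *(6) by (simp add: homeomorphism_def)
  next
    case (Suc n)
    have "C_k_on n V (dir_deriv g v)" for v
    proof (rule C_k_on_cong[OF \<open>open V\<close>])
      show "C_k_on n V (\<lambda>y. inv (\<lambda>v. dir_deriv f v (g y)) v)"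
        by (rule C_k_on_compose[OF \<open>open V\<close> \<open>open U'\<close> smooth_on_D[OF smB] Suc]) (simp add: gV)
      show "\<And>y. y \<in> V \<Longrightarrow> inv (\<lambda>v. dir_deriv f v (g y)) v = dir_deriv g v y"
        using dir_deriv_eq[OF *(7)] by simp
    qed
    then show ?case
      using *(7) by (auto simp: differentiable_def)
  qed
  then show ?thesis
    using * by (intro that[of U' V g]) (auto simp: smooth_on_def)
qed

section \<open>Smoothness of the signed distance\<close>

definition signed_dist :: "'a::metric_space set \<Rightarrow> 'a \<Rightarrow> real"
  where "signed_dist \<Omega> q = (if q \<in> \<Omega> then - infdist q (frontier \<Omega>) else infdist q (frontier \<Omega>))"

section \<open>The frontier as a regular zero set\<close>

lemma defining_on_grad_nonzero:
  assumes "defining_on \<Omega> U \<rho>" "q \<in> frontier \<Omega> \<inter> U"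
  shows "grad \<rho> q \<noteq> 0"
proof
  assume "grad \<rho> q = 0"
  moreover have "\<rho> differentiable (at q)"
    using assms smooth_on_differentiable unfolding defining_on_def by blast
  ultimately have "frechet_derivative \<rho> (at q) = (\<lambda>v. 0)"
    using dir_deriv_eq_grad[of \<rho> q] by (simp add: dir_deriv_def fun_eq_iff)
  then show False
    using assms by (auto simp: defining_on_def)
qed

lemma defining_on_frontier_zero:
  assumes "open \<Omega>" "defining_on \<Omega> U \<rho>" "q \<in> frontier \<Omega> \<inter> U"
  shows "\<rho> q = 0"
proof -
  have "q \<notin> \<Omega>" "q \<in> closure \<Omega>"
    using assms by (auto simp: frontier_def interior_open)
  have U: "open U" "continuous_on U \<rho>" "\<Omega> \<inter> U = {q\<in>U. \<rho> q < 0}"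
    using assms(2) smooth_on_continuous_on by (auto simp: defining_on_def)
  have "open (U \<inter> \<rho> -` {0<..})"
    using U(1,2) by (simp add: continuous_open_preimage)
  moreover have "(U \<inter> \<rho> -` {0<..}) \<inter> \<Omega> = {}"
  proof (rule equals0I)
    fix x assume "x \<in> (U \<inter> \<rho> -` {0<..}) \<inter> \<Omega>"
    then have "x \<in> \<Omega> \<inter> U" "\<rho> x > 0" by auto
    then show False unfolding U(3) by simp
  qed
  ultimately have "q \<notin> U \<inter> \<rho> -` {0<..}"
    using \<open>q \<in> closure \<Omega>\<close> open_Int_closure_eq_empty by blast
  moreover have "\<not> \<rho> q < 0"
    using \<open>q \<notin> \<Omega>\<close> U(3) assms(3) by blast
  ultimately show ?thesis
    using assms(3) by auto
qed

text \<open>\<open>defining_on\<close> prescribes only where \<open>\<rho>\<close> is negative, so a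
  zero could lie outside the closure of \<open>\<Omega>\<close>. There it would be a minimum of
  \<open>\<rho>\<close> on an open set, which the nonzero gradient excludes.\<close>

lemma defining_on_zero_frontier:
  assumes "open \<Omega>" "defining_on \<Omega> U \<rho>" "q \<in> U" "\<rho> q = 0" "grad \<rho> q \<noteq> 0"
  shows "q \<in> frontier \<Omega>"
proof -
  have U: "open U" "smooth_on U \<rho>" "\<Omega> \<inter> U = {q\<in>U. \<rho> q < 0}"
    using assms(2) by (auto simp: defining_on_def)
  have "q \<in> closure \<Omega>"
  proof (rule ccontr)
    assume "q \<notin> closure \<Omega>"
    then have "open (U - closure \<Omega>)" "q \<in> U - closure \<Omega>"
      using U(1) assms(3) by auto
    moreover have "\<rho> q \<le> \<rho> y" if "y \<in> U - closure \<Omega>" for y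
      using that U(3) closure_subset[of \<Omega>] assms(4) by force
    moreover have "(\<rho> has_derivative (\<lambda>v. grad \<rho> q \<bullet> v)) (at q)"
      by (intro has_derivative_grad smooth_on_differentiable[OF U(2) assms(3)])
    ultimately have "(\<lambda>v. grad \<rho> q \<bullet> v) = (\<lambda>v. 0)"
      using differential_zero_maxmin[of q "U - closure \<Omega>" \<rho>] by blast
    then show False
      using assms(5) by (metis inner_eq_zero_iff)
  qed
  moreover have "q \<notin> \<Omega> \<inter> U"
    unfolding U(3) using assms(4) by simp
  then have "q \<notin> \<Omega>"
    using assms(3) by simp
  ultimately show ?thesis
    using assms(1) by (simp add: frontier_def interior_open)
qed

section \<open>Normal coordinates near a regular zero set\<close>

context
  fixes \<rho> :: "'a::euclidean_space \<Rightarrow> real" and U :: "'a set"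
  assumes U: "open U" and sm: "smooth_on U \<rho>" and nz: "\<And>q. q \<in> U \<Longrightarrow> grad \<rho> q \<noteq> 0"
begin

text \<open>A power of the squared length stands in for the norm, so that smoothness follows from
  \<open>smooth_on_powr\<close>.\<close>

definition unit_normal :: "'a \<Rightarrow> 'a"
  where "unit_normal q = ((grad \<rho> q \<bullet> grad \<rho> q) powr - (1/2)) *\<^sub>R grad \<rho> q"

lemma norm_grad_powr: "q \<in> U \<Longrightarrow> (grad \<rho> q \<bullet> grad \<rho> q) powr - (1/2) = 1 / norm (grad \<rho> q)"
  by (simp add: norm_eq_sqrt_inner powr_minus_divide powr_half_sqrt)

lemma grad_eq_unit_normal: "q \<in> U \<Longrightarrow> grad \<rho> q = norm (grad \<rho> q) *\<^sub>R unit_normal q"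
  using nz by (simp add: unit_normal_def norm_grad_powr)

lemma norm_unit_normal: "q \<in> U \<Longrightarrow> norm (unit_normal q) = 1"
  using nz by (simp add: unit_normal_def norm_grad_powr)

lemma smooth_on_unit_normal: "smooth_on U unit_normal"
  unfolding unit_normal_def[abs_def]
proof (intro smooth_on_scaleR smooth_on_grad U sm)
  show "smooth_on U (\<lambda>q. (grad \<rho> q \<bullet> grad \<rho> q) powr - (1/2))"
    by (rule smooth_on_compose[OF U _ smooth_on_powr])
      (use nz in \<open>auto intro!: smooth_on_inner smooth_on_grad U sm\<close>)
qed

text \<open>The inverse function theorem is applied to
  \<open>(p, t) \<mapsto> (p + t n(p), \<rho> p)\<close>, one dimension higher, so that the
  hypersurface needs no charts. \<open>foot\<close> and \<open>s\<close> are the components of the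
  inverse on the slice where the last coordinate is 0.\<close>

lemma normal_coordinates:
  assumes p0: "p0 \<in> U" "\<rho> p0 = 0"
  obtains W foot s where "open W" "p0 \<in> W" "W \<subseteq> U" "smooth_on W foot" "smooth_on W s"
    "\<And>q. q \<in> W \<Longrightarrow> foot q \<in> U \<and> \<rho> (foot q) = 0 \<and> foot q + s q *\<^sub>R unit_normal (foot q) = q"
    "\<And>q. q \<in> W \<Longrightarrow> grad s q = unit_normal (foot q)"
    "\<And>p. p \<in> W \<Longrightarrow> \<rho> p = 0 \<Longrightarrow> foot p = p \<and> s p = 0"
proof -
  define F where "F = (\<lambda>z. (fst z + snd z *\<^sub>R unit_normal (fst z), \<rho> (fst z)))"
  have UU: "open (U \<times> (UNIV :: real set))"
    by (simp add: U open_Times)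
  have fst: "smooth_on (U \<times> (UNIV :: real set)) fst" "smooth_on (U \<times> (UNIV :: real set)) snd"
    using smooth_on_linear[OF UU bounded_linear_fst smooth_on_id]
      smooth_on_linear[OF UU bounded_linear_snd smooth_on_id] by auto
  have smF: "smooth_on (U \<times> (UNIV :: real set)) F"
    unfolding F_def
    by (intro smooth_on_Pair smooth_on_add smooth_on_scaleR UU fst
        smooth_on_compose[OF UU U smooth_on_unit_normal, where g = fst]
        smooth_on_compose[OF UU U sm, where g = fst]) auto
  have n: "(unit_normal has_derivative (\<lambda>v. dir_deriv unit_normal v q)) (at q)" if "q \<in> U" for q
    using smooth_on_has_derivative[OF smooth_on_unit_normal that] .
  have DF: "dir_deriv F z (p0, 0) = (fst z + snd z *\<^sub>R unit_normal p0, grad \<rho> p0 \<bullet> fst z)" for z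
  proof -
    have fst': "(fst has_derivative fst) (at (p0, 0::real))"
      using has_derivative_fst[OF has_derivative_ident] .
    have "((\<lambda>z. unit_normal (fst z)) has_derivative (\<lambda>z. dir_deriv unit_normal (fst z) p0)) (at (p0, 0::real))"
      using has_derivative_compose[OF fst', of unit_normal] n[OF p0(1)] by simp
    moreover have "((\<lambda>z. \<rho> (fst z)) has_derivative (\<lambda>z. grad \<rho> p0 \<bullet> fst z)) (at (p0, 0::real))"
      using has_derivative_compose[OF fst', of \<rho>] has_derivative_grad[OF smooth_on_differentiable[OF sm p0(1)]]
      by simp
    ultimately show ?thesis
      unfolding F_def
      by (intro dir_deriv_eq) (auto intro!: derivative_eq_intros)
  qed
  have p0': "(p0, 0::real) \<in> U \<times> UNIV"
    using p0 by simp
  have "inj (\<lambda>z. dir_deriv F z (p0, 0))"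
  proof (subst linear_injective_0)
    show "linear (\<lambda>z. dir_deriv F z (p0, 0))"
      by (intro linear_dir_deriv smooth_on_differentiable[OF smF p0'])
    have "z = 0" if "fst z + snd z *\<^sub>R unit_normal p0 = 0" "grad \<rho> p0 \<bullet> fst z = 0" for z :: "'a \<times> real"
    proof -
      have v: "fst z = - (snd z *\<^sub>R unit_normal p0)"
        using that(1) by (simp add: eq_neg_iff_add_eq_0)
      have "grad \<rho> p0 \<bullet> unit_normal p0 \<noteq> 0"
        using grad_eq_unit_normal[OF p0(1)] norm_unit_normal[OF p0(1)] nz[OF p0(1)]
        by (metis inner_commute inner_scaleR_right inner_eq_zero_iff mult_eq_0_iff scale_eq_0_iff norm_eq_zero zero_neq_one)
      then have "snd z = 0"
        using that(2) by (simp add: v)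
      then show ?thesis
        using v by (simp add: prod_eq_iff)
    qed
    then show "\<forall>z. dir_deriv F z (p0, 0) = 0 \<longrightarrow> z = 0"
      by (auto simp: DF zero_prod_def)
  qed
  from smooth_on_local_inverse[OF UU smF p0' this]
  obtain U' V g where UV: "open U'" "U' \<subseteq> U \<times> UNIV" "(p0, 0) \<in> U'" "open V" "F (p0, 0) \<in> V"
    "homeomorphism U' V F g" "smooth_on V g"
    by metis
  \<comment> \<open>Membership in \<open>V\<close> gives coordinates to \<open>q\<close>. Requiring
    \<open>(q, 0) \<in> U'\<close> as well makes \<open>g\<close> undo \<open>F\<close> at
    \<open>(q, 0)\<close>, which yields \<open>foot p = p\<close> on the hypersurface.\<close>
  define W where "W = U \<inter> (\<lambda>q. (q, 0)) -` V \<inter> (\<lambda>q. (q, 0)) -` U'"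
  have "F (p0, 0) = (p0, 0)"
    using p0 by (simp add: F_def)
  then have W: "open W" "p0 \<in> W" "W \<subseteq> U"
    using UV p0 U unfolding W_def by (auto intro!: open_Int continuous_open_vimage continuous_intros)
  define foot where "foot = (\<lambda>q. fst (g (q, 0)))"
  define s where "s = (\<lambda>q. snd (g (q, 0)))"
  have "smooth_on W (\<lambda>q. g (q, 0))"
    by (rule smooth_on_compose[OF W(1) UV(4,7)])
      (use smooth_on_Pair[OF W(1) smooth_on_id smooth_on_const] in \<open>auto simp: W_def\<close>)
  then have sm': "smooth_on W foot" "smooth_on W s"
    unfolding foot_def s_def
    by (auto intro!: smooth_on_linear[OF W(1) bounded_linear_fst] smooth_on_linear[OF W(1) bounded_linear_snd])
  have foot: "foot q \<in> U \<and> \<rho> (foot q) = 0 \<and> foot q + s q *\<^sub>R unit_normal (foot q) = q" if "q \<in> W" for q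
  proof -
    have "F (g (q, 0)) = (q, 0)"
      using that homeomorphism_apply2[OF UV(6)] by (auto simp: W_def)
    moreover have "g (q, 0) \<in> U'"
      using that homeomorphism_image2[OF UV(6)] by (auto simp: W_def)
    ultimately show ?thesis
      using UV(2) by (auto simp: F_def foot_def s_def)
  qed
  \<comment> \<open>The identity \<open>foot q + s q *\<^sub>R unit_normal (foot q) = q\<close> is
    differentiated and paired with the normal: the foot moves tangentially and the derivative of a
    unit field is orthogonal to it, so only the derivative of \<open>s\<close> survives.\<close>
  have "grad s q = unit_normal (foot q)" if "q \<in> W" for q
  proof (rule grad_eqI)
    let ?n = "unit_normal (foot q)"
    have Df: "(foot has_derivative (\<lambda>v. dir_deriv foot v q)) (at q)"
      and Ds: "(s has_derivative (\<lambda>v. dir_deriv s v q)) (at q)"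
      using that sm' smooth_on_has_derivative by blast+
    have fU: "foot q \<in> U" using foot[OF that] by simp
    have Dn: "((\<lambda>q. unit_normal (foot q)) has_derivative (\<lambda>v. dir_deriv unit_normal (dir_deriv foot v q) (foot q))) (at q)"
      using has_derivative_compose[OF Df n[OF fU]] .
    have nf: "?n \<bullet> dir_deriv foot v q = 0" for v
    proof -
      have "((\<lambda>q. \<rho> (foot q)) has_derivative (\<lambda>v. grad \<rho> (foot q) \<bullet> dir_deriv foot v q)) (at q)"
        using has_derivative_compose[OF Df has_derivative_grad[OF smooth_on_differentiable[OF sm fU]]] .
      moreover have "((\<lambda>q. \<rho> (foot q)) has_derivative (\<lambda>v. 0)) (at q)"
        by (rule has_derivative_transform_within_open[OF has_derivative_const[of 0] W(1) that])
          (use foot in auto)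
      ultimately have "(\<lambda>v. grad \<rho> (foot q) \<bullet> dir_deriv foot v q) = (\<lambda>v. 0)"
        by (rule has_derivative_unique)
      then have "grad \<rho> (foot q) \<bullet> dir_deriv foot v q = 0" by meson
      then show ?thesis
        by (simp add: unit_normal_def)
    qed
    have nn: "?n \<bullet> dir_deriv unit_normal w (foot q) = 0" for w
    proof -
      have "((\<lambda>q. unit_normal q \<bullet> unit_normal q) has_derivative
          (\<lambda>w. ?n \<bullet> dir_deriv unit_normal w (foot q) + dir_deriv unit_normal w (foot q) \<bullet> ?n)) (at (foot q))"
        by (rule has_derivative_inner[OF n[OF fU] n[OF fU]])
      moreover have "((\<lambda>q. unit_normal q \<bullet> unit_normal q) has_derivative (\<lambda>v. 0)) (at (foot q))"
        by (rule has_derivative_transform_within_open[OF has_derivative_const[of 1] U fU])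
          (use norm_unit_normal in \<open>simp add: dot_square_norm\<close>)
      ultimately have "(\<lambda>w. ?n \<bullet> dir_deriv unit_normal w (foot q) + dir_deriv unit_normal w (foot q) \<bullet> ?n) = (\<lambda>v. 0)"
        by (rule has_derivative_unique)
      from fun_cong[OF this, of w] show ?thesis
        by (simp add: inner_commute)
    qed
    have "((\<lambda>q. foot q + s q *\<^sub>R unit_normal (foot q)) has_derivative
      (\<lambda>v. dir_deriv foot v q + (s q *\<^sub>R dir_deriv unit_normal (dir_deriv foot v q) (foot q) + dir_deriv s v q *\<^sub>R ?n))) (at q)"
      by (intro has_derivative_add has_derivative_scaleR Df Ds Dn)
    moreover have "((\<lambda>q. foot q + s q *\<^sub>R unit_normal (foot q)) has_derivative (\<lambda>v. v)) (at q)"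
      by (rule has_derivative_transform_within_open[OF has_derivative_ident W(1) that])
        (use foot in auto)
    ultimately have "(\<lambda>v. dir_deriv foot v q + (s q *\<^sub>R dir_deriv unit_normal (dir_deriv foot v q) (foot q) + dir_deriv s v q *\<^sub>R ?n)) = (\<lambda>v. v)"
      by (rule has_derivative_unique)
    then have v: "dir_deriv foot v q + (s q *\<^sub>R dir_deriv unit_normal (dir_deriv foot v q) (foot q) + dir_deriv s v q *\<^sub>R ?n) = v" for v
      by meson
    have "?n \<bullet> v = dir_deriv s v q" for v
    proof -
      have "?n \<bullet> (dir_deriv foot v q + (s q *\<^sub>R dir_deriv unit_normal (dir_deriv foot v q) (foot q) + dir_deriv s v q *\<^sub>R ?n))
        = dir_deriv s v q"
        using norm_unit_normal[OF fU] by (simp add: inner_right_distrib nf nn dot_square_norm)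
      then show ?thesis
        unfolding v .
    qed
    then show "(s has_derivative (\<lambda>v. ?n \<bullet> v)) (at q)"
      using Ds by simp
  qed
  moreover have "foot p = p \<and> s p = 0" if "p \<in> W" "\<rho> p = 0" for p
  proof -
    have "g (F (p, 0)) = (p, 0)"
      using that homeomorphism_apply1[OF UV(6)] by (auto simp: W_def)
    then show ?thesis
      using that by (simp add: F_def foot_def s_def)
  qed
  ultimately show ?thesis
    using that[OF W sm' foot] by blast
qed

end

text \<open>The coordinate \<open>s\<close> is identified with the signed distance, first in
  absolute value and then in sign. Writing the foot point as
  \<open>q - d q *\<^sub>R grad d q\<close> lets later arguments refer to \<open>d\<close>
  alone.\<close>

lemma signed_dist_local:
  fixes \<Omega> :: "C2 set"
  assumes "open \<Omega>" and def: "defining_on \<Omega> U \<rho>" and p0: "p0 \<in> frontier \<Omega> \<inter> U"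
  defines "d \<equiv> signed_dist \<Omega>"
  obtains W where "open W" "p0 \<in> W" "W \<subseteq> U" "smooth_on W d"
    "\<And>q. q \<in> W \<Longrightarrow> norm (grad d q) = 1"
    "\<And>q. q \<in> W \<Longrightarrow> q - d q *\<^sub>R grad d q \<in> frontier \<Omega> \<inter> W"
    "\<And>q. q \<in> W \<Longrightarrow> grad d (q - d q *\<^sub>R grad d q) = grad d q"
    "\<And>p. p \<in> frontier \<Omega> \<inter> W \<Longrightarrow> grad \<rho> p = norm (grad \<rho> p) *\<^sub>R grad d p"
proof -
  have U: "open U" "smooth_on U \<rho>" "\<Omega> \<inter> U = {q\<in>U. \<rho> q < 0}"
    using def by (auto simp: defining_on_def)
  have cont: "continuous_on U (grad \<rho>)"
    by (intro smooth_on_continuous_on smooth_on_grad U)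
  define U1 where "U1 = {q \<in> U. grad \<rho> q \<noteq> 0}"
  have "U1 = U \<inter> grad \<rho> -` (- {0})"
    by (auto simp: U1_def)
  then have "open U1"
    using continuous_open_preimage[OF cont U(1), of "- {0}"] by (simp add: open_Compl)
  have "p0 \<in> U1" "\<rho> p0 = 0"
    using p0 defining_on_grad_nonzero[OF def] defining_on_frontier_zero[OF \<open>open \<Omega>\<close> def]
    by (auto simp: U1_def)
  have smU1: "smooth_on U1 \<rho>" and nz: "\<And>q. q \<in> U1 \<Longrightarrow> grad \<rho> q \<noteq> 0"
    using smooth_on_subset[OF U(2)] by (auto simp: U1_def)
  note ctx = \<open>open U1\<close> smU1 nz
  define n where "n = unit_normal \<rho>"
  obtain V foot s where V: "open V" "p0 \<in> V" "V \<subseteq> U1" "smooth_on V foot" "smooth_on V s"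
    and foot: "\<And>q. q \<in> V \<Longrightarrow> foot q \<in> U1 \<and> \<rho> (foot q) = 0 \<and> foot q + s q *\<^sub>R n (foot q) = q"
    and grad_s: "\<And>q. q \<in> V \<Longrightarrow> grad s q = n (foot q)"
    and foot_id: "\<And>p. p \<in> V \<Longrightarrow> \<rho> p = 0 \<Longrightarrow> foot p = p \<and> s p = 0"
    unfolding n_def using normal_coordinates[OF ctx \<open>p0 \<in> U1\<close> \<open>\<rho> p0 = 0\<close>] by metis
  have norm_n: "norm (n q) = 1" and grad_n: "grad \<rho> q = norm (grad \<rho> q) *\<^sub>R n q" if "q \<in> U1" for q
    unfolding n_def using norm_unit_normal[OF ctx that] grad_eq_unit_normal[OF ctx that] by auto
  have foot_frontier: "foot q \<in> frontier \<Omega>" if "q \<in> V" for q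
    using foot[OF that] defining_on_zero_frontier[OF \<open>open \<Omega>\<close> def] by (auto simp: U1_def)
  have frontier_zero: "\<rho> p = 0" if "p \<in> frontier \<Omega> \<inter> U" for p
    using defining_on_frontier_zero[OF \<open>open \<Omega>\<close> def that] .
  have cont_foot: "continuous_on V foot"
    by (rule smooth_on_continuous_on[OF V(4)])
  \<comment> \<open>By continuity, \<open>\<rho>\<close> increases in every normal direction
    throughout a small ball. This decides the sign of \<open>s\<close> below.\<close>
  obtain r0 where r0: "r0 > 0" "ball p0 r0 \<subseteq> U1"
    and pos: "\<And>x y. x \<in> ball p0 r0 \<Longrightarrow> y \<in> ball p0 r0 \<Longrightarrow> grad \<rho> x \<bullet> n y > 0"
  proof -
    define S where "S = (U1 \<times> U1) \<inter> (\<lambda>z. grad \<rho> (fst z) \<bullet> grad \<rho> (snd z)) -` {0<..}"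
    have "open S" unfolding S_def
    proof (rule continuous_open_preimage)
      show "continuous_on (U1 \<times> U1) (\<lambda>z. grad \<rho> (fst z) \<bullet> grad \<rho> (snd z))"
        by (intro continuous_on_inner continuous_on_compose2[OF cont] continuous_intros)
          (auto simp: U1_def)
    qed (simp_all add: \<open>open U1\<close> open_Times)
    moreover have "(p0, p0) \<in> S"
      using \<open>p0 \<in> U1\<close> nz by (simp add: S_def)
    ultimately obtain A B where AB: "open A" "open B" "p0 \<in> A" "p0 \<in> B" "A \<times> B \<subseteq> S"
      by (auto elim: open_prod_elim)
    then have "open (A \<inter> B)" "p0 \<in> A \<inter> B" by auto
    then obtain r where r: "r > 0" "ball p0 r \<subseteq> A \<inter> B"
      using open_contains_ball by blast
    show ?thesis
    proof
      show "ball p0 r \<subseteq> U1"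
        using r(2) AB(4,5) by (auto simp: S_def)
      fix x y assume "x \<in> ball p0 r" "y \<in> ball p0 r"
      then have "(x, y) \<in> S" using r(2) AB(5) by blast
      then have "grad \<rho> x \<bullet> grad \<rho> y > 0" "y \<in> U1" by (auto simp: S_def)
      then have "norm (grad \<rho> y) * (grad \<rho> x \<bullet> n y) > 0"
        using grad_n[of y] by (metis inner_scaleR_right)
      then show "grad \<rho> x \<bullet> n y > 0"
        by (simp add: zero_less_mult_iff)
    qed (use r in auto)
  qed
  have "open (V \<inter> foot -` ball p0 r0)"
    using cont_foot V(1) by (simp add: continuous_open_preimage)
  moreover have "p0 \<in> V \<inter> foot -` ball p0 r0"
    using foot_id[OF V(2) \<open>\<rho> p0 = 0\<close>] V(2) r0(1) by simp
  ultimately have "open (ball p0 r0 \<inter> (V \<inter> foot -` ball p0 r0))" "p0 \<in> ball p0 r0 \<inter> (V \<inter> foot -` ball p0 r0)"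
    using r0(1) by auto
  then obtain r where r: "r > 0" "ball p0 r \<subseteq> ball p0 r0 \<inter> (V \<inter> foot -` ball p0 r0)"
    using open_contains_ball by blast
  have rV: "q \<in> V" "foot q \<in> ball p0 r0" "q \<in> ball p0 r0" "q \<in> U1" "q \<in> U" if "q \<in> ball p0 r" for q
    using that r(2) r0(2) by (auto simp: U1_def)
  \<comment> \<open>Half the radius: a boundary point nearest to \<open>q\<close> is no farther from
    \<open>q\<close> than \<open>p0\<close> is, hence it lies within \<open>r\<close> of
    \<open>p0\<close>.\<close>
  define W1 where "W1 = ball p0 (r / 2)"
  have W1r: "W1 \<subseteq> ball p0 r" using r(1) by (auto simp: W1_def)
  \<comment> \<open>\<open>\<le>\<close>: \<open>s\<close> is 1-Lipschitz and vanishes on the boundary; \<open>\<ge>\<close>: \<open>foot q\<close> is a boundary point.\<close>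
  have abs_s: "\<bar>s q\<bar> = infdist q (frontier \<Omega>)" if "q \<in> W1" for q
  proof (rule antisym)
    have q: "q \<in> ball p0 r" using that W1r by auto
    have "frontier \<Omega> \<noteq> {}" using p0 by auto
    then obtain p where p: "p \<in> frontier \<Omega>" "infdist q (frontier \<Omega>) = dist q p"
      using infdist_attains_inf[of "frontier \<Omega>" q] by auto
    have "dist q p \<le> dist q p0"
      using p p0 infdist_le[of p0 "frontier \<Omega>" q] by simp
    then have "p \<in> ball p0 r"
      using that dist_triangle[of p0 p q] by (auto simp: W1_def dist_commute)
    then have "s p = 0"
      using foot_id frontier_zero p rV by blast
    have "norm (s q - s p) \<le> 1 * norm (q - p)"
    proof (rule differentiable_bound[of "ball p0 r" s "\<lambda>x v. grad s x \<bullet> v"])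
      fix x assume "x \<in> ball p0 r"
      then have x: "x \<in> V" using rV by blast
      show "(s has_derivative (\<lambda>v. grad s x \<bullet> v)) (at x within ball p0 r)"
        by (rule has_derivative_at_withinI[OF has_derivative_grad[OF smooth_on_differentiable[OF V(5) x]]])
      have "norm (grad s x) = 1"
        using grad_s[OF x] norm_n foot[OF x] by simp
      then show "onorm (\<lambda>v. grad s x \<bullet> v) \<le> 1"
        using Cauchy_Schwarz_ineq2[of "grad s x"] by (intro onorm_le) simp
    qed (use q \<open>p \<in> ball p0 r\<close> in auto)
    then show "\<bar>s q\<bar> \<le> infdist q (frontier \<Omega>)"
      using \<open>s p = 0\<close> p by (simp add: dist_norm)
    have "infdist q (frontier \<Omega>) \<le> dist q (foot q)"
      by (rule infdist_le[OF foot_frontier[OF rV(1)[OF q]]])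
    also have "\<dots> = norm (s q *\<^sub>R n (foot q))"
      using foot[OF rV(1)[OF q]] by (metis add_diff_cancel_left' dist_norm)
    also have "\<dots> = \<bar>s q\<bar>"
      using foot[OF rV(1)[OF q]] norm_n by simp
    finally show "infdist q (frontier \<Omega>) \<le> \<bar>s q\<bar>" .
  qed
  have sign: "q \<in> \<Omega> \<longleftrightarrow> s q < 0" if "q \<in> W1" for q
  proof -
    have q: "q \<in> ball p0 r" using that W1r by auto
    note fq = foot[OF rV(1)[OF q]]
    have seg: "foot q + t *\<^sub>R (c *\<^sub>R n (foot q)) \<in> ball p0 r0" if "t \<in> {0..h}" "h > 0" "s q = h * c" for t h c
    proof -
      have "foot q + t *\<^sub>R (c *\<^sub>R n (foot q)) = (1 - t / h) *\<^sub>R foot q + (t / h) *\<^sub>R (foot q + s q *\<^sub>R n (foot q))"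
        using that by (simp add: scaleR_diff_left scaleR_add_right)
      also have "\<dots> = (1 - t / h) *\<^sub>R foot q + (t / h) *\<^sub>R q"
        using fq by simp
      also have "\<dots> \<in> ball p0 r0"
        using that by (intro convexD[OF convex_ball rV(2,3)[OF q]]) auto
      finally show ?thesis .
    qed
    \<comment> \<open>\<open>mvt_segment\<close> needs a positive step, so the signed displacement
      \<open>s q\<close> is split into a length \<open>h\<close> and a sign \<open>c\<close>, used
      below with 1 and -1.\<close>
    have mvt: "\<exists>x\<in>ball p0 r0. \<rho> q = h * (grad \<rho> x \<bullet> (c *\<^sub>R n (foot q)))" if "h > 0" "s q = h * c" for h c
    proof -
      have diff: "\<rho> differentiable (at (foot q + t *\<^sub>R (c *\<^sub>R n (foot q))))" if "t \<in> {0..h}" for t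
        using seg[OF that \<open>h > 0\<close> \<open>s q = h * c\<close>] r0(2) smooth_on_differentiable[OF smU1] by blast
      obtain t where t: "t \<in> {0<..<h}" "\<rho> (foot q + h *\<^sub>R (c *\<^sub>R n (foot q))) - \<rho> (foot q)
          = h * dir_deriv \<rho> (c *\<^sub>R n (foot q)) (foot q + t *\<^sub>R (c *\<^sub>R n (foot q)))"
        using mvt_segment[OF \<open>h > 0\<close> diff] by blast
      have t': "t \<in> {0..h}" using t(1) by auto
      have "dir_deriv \<rho> (c *\<^sub>R n (foot q)) (foot q + t *\<^sub>R (c *\<^sub>R n (foot q)))
          = grad \<rho> (foot q + t *\<^sub>R (c *\<^sub>R n (foot q))) \<bullet> (c *\<^sub>R n (foot q))"
        by (rule dir_deriv_eq_grad[OF diff[OF t']])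
      moreover have "foot q + h *\<^sub>R (c *\<^sub>R n (foot q)) = q"
        using fq that by simp
      ultimately show ?thesis
        using t(2) fq seg[OF t' that] by (metis diff_zero)
    qed
    consider "s q < 0" | "s q = 0" | "s q > 0" by linarith
    then have "\<rho> q < 0 \<longleftrightarrow> s q < 0"
    proof cases
      case 1
      then obtain x where "x \<in> ball p0 r0" "\<rho> q = - s q * (grad \<rho> x \<bullet> ((-1) *\<^sub>R n (foot q)))"
        using mvt[of "- s q" "-1"] by auto
      with 1 pos[of x "foot q"] rV(2)[OF q] show ?thesis
        by (simp add: mult_neg_pos)
    next
      case 2
      then have "\<rho> q = 0"
        using fq by (metis add.right_neutral scaleR_zero_left)
      with 2 show ?thesis by simp
    next
      case 3
      then obtain x where "x \<in> ball p0 r0" "\<rho> q = s q * (grad \<rho> x \<bullet> (1 *\<^sub>R n (foot q)))"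
        using mvt[of "s q" 1] by auto
      with 3 pos[of x "foot q"] rV(2)[OF q] show ?thesis
        by (simp add: not_less)
    qed
    then show ?thesis
      using U(3) rV(5)[OF q] by blast
  qed
  have d_eq: "d q = s q" if "q \<in> W1" for q
    using abs_s[OF that] sign[OF that] by (auto simp: d_def signed_dist_def)
  have "open W1" by (simp add: W1_def)
  have grad_d: "grad d q = n (foot q)" if "q \<in> W1" for q
    using grad_local[OF \<open>open W1\<close> that d_eq] grad_s rV(1) that W1r by auto
  \<comment> \<open>Intersecting with the preimage makes the neighbourhood stable under
    \<open>foot\<close>, which is the identity on boundary points of \<open>W1\<close>.\<close>
  define W where "W = W1 \<inter> foot -` W1"
  have WW1: "W \<subseteq> W1" by (auto simp: W_def)
  have W1V: "W1 \<subseteq> V" using W1r rV by blast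
  have foot_W1: "foot p = p" if "p \<in> frontier \<Omega> \<inter> W1" for p
    using that foot_id[of p] frontier_zero[of p] W1r rV by blast
  have foot_W: "foot q \<in> frontier \<Omega> \<inter> W \<and> q - d q *\<^sub>R grad d q = foot q" if "q \<in> W" for q
  proof -
    have "q \<in> W1" "foot q \<in> W1" "q \<in> V" using that W1V by (auto simp: W_def)
    then have "foot (foot q) = foot q"
      using foot_W1 foot_frontier by blast
    moreover have "q - s q *\<^sub>R n (foot q) = foot q"
      using foot[OF \<open>q \<in> V\<close>] by (simp add: diff_eq_eq)
    ultimately show ?thesis
      using foot_frontier[OF \<open>q \<in> V\<close>] d_eq grad_d \<open>q \<in> W1\<close> \<open>foot q \<in> W1\<close> by (simp add: W_def)
  qed
  show ?thesis
  proof (rule that[of W])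
    show "open W"
      unfolding W_def using \<open>open W1\<close> continuous_on_subset[OF cont_foot W1V]
      by (simp add: continuous_open_preimage)
    have "p0 \<in> W1" using r(1) by (simp add: W1_def)
    then show "p0 \<in> W"
      using foot_W1[of p0] p0 by (simp add: W_def)
    show "W \<subseteq> U"
      using WW1 W1r rV by blast
    show "smooth_on W d"
    proof (rule smooth_on_cong[OF \<open>open W\<close>])
      show "smooth_on W s" using smooth_on_subset[OF V(5)] W1V WW1 by blast
    qed (use d_eq WW1 in auto)
    show "norm (grad d q) = 1" if "q \<in> W" for q
      using that WW1 W1V grad_d foot norm_n by (metis subsetD)
    show "q - d q *\<^sub>R grad d q \<in> frontier \<Omega> \<inter> W" if "q \<in> W" for q
      using foot_W[OF that] by simp
    show "grad d (q - d q *\<^sub>R grad d q) = grad d q" if "q \<in> W" for q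
    proof -
      have "q \<in> W1" "foot q \<in> frontier \<Omega> \<inter> W1"
        using that foot_W[OF that] WW1 by auto
      then show ?thesis
        using foot_W[OF that] foot_W1[of "foot q"] grad_d[of "foot q"] grad_d[of q] by simp
    qed
    show "grad \<rho> p = norm (grad \<rho> p) *\<^sub>R grad d p" if "p \<in> frontier \<Omega> \<inter> W" for p
    proof -
      have "p \<in> frontier \<Omega> \<inter> W1" "p \<in> U1"
        using that WW1 W1V V(3) by auto
      then show ?thesis
        using foot_W1[of p] grad_d[of p] grad_n[of p] by simp
    qed
  qed
qed

section \<open>Linear algebra of the Levi form\<close>

lemma J_simps:
  fixes a b :: C2
  shows "\<i> *s (\<i> *s a) = - a" "(\<i> *s a) \<bullet> (\<i> *s b) = a \<bullet> b" "(\<i> *s a) \<bullet> b = - (a \<bullet> (\<i> *s b))"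
    "(\<i> *s a) \<bullet> a = 0" "a \<bullet> (\<i> *s a) = 0" "norm (\<i> *s a) = norm a"
    "\<i> *s (a + b) = \<i> *s a + \<i> *s b" "\<i> *s (a - b) = \<i> *s a - \<i> *s b" "\<i> *s (c *\<^sub>R a) = c *\<^sub>R (\<i> *s a)"
    "\<i> *s (- a) = - (\<i> *s a)"
  by (simp_all add: vec_eq_iff inner_vec_def sum_2 inner_complex_def norm_eq_sqrt_inner algebra_simps
      complex_eq_iff)

text \<open>The two real orthogonality conditions are the real and imaginary parts of one Hermitian
  equation, whose solutions in two complex variables form a complex line. The vanishing determinant
  provides the complex factor \<open>c\<close>.\<close>

lemma complex_line:
  fixes \<nu> L l :: C2
  assumes "\<nu> \<noteq> 0" "L \<noteq> 0" "\<nu> \<bullet> L = 0" "\<nu> \<bullet> (\<i> *s L) = 0" "\<nu> \<bullet> l = 0" "\<nu> \<bullet> (\<i> *s l) = 0"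
  obtains r s where "l = r *\<^sub>R L + s *\<^sub>R (\<i> *s L)"
proof -
  have perp: "cnj (\<nu> $ 1) * x $ 1 + cnj (\<nu> $ 2) * x $ 2 = 0" if "\<nu> \<bullet> x = 0" "\<nu> \<bullet> (\<i> *s x) = 0" for x
    using that by (simp add: inner_vec_def sum_2 inner_complex_def complex_eq_iff)
  have det: "l $ 1 * L $ 2 = l $ 2 * L $ 1"
  proof (cases "\<nu> $ 1 = 0")
    case True
    then have "\<nu> $ 2 \<noteq> 0"
      using assms(1) by (auto simp: vec_eq_iff forall_2)
    then show ?thesis
      using True perp[OF assms(3,4)] perp[OF assms(5,6)] by simp
  next
    case False
    have "cnj (\<nu> $ 1) * (l $ 1 * L $ 2 - l $ 2 * L $ 1) = 0"
      using perp[OF assms(3,4)] perp[OF assms(5,6)] by algebra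
    with False show ?thesis by simp
  qed
  obtain c where c: "l = c *s L"
  proof (cases "L $ 1 = 0")
    case True
    then have "L $ 2 \<noteq> 0"
      using assms(2) by (auto simp: vec_eq_iff forall_2)
    then show ?thesis
      using True det by (intro that[of "l $ 2 / L $ 2"]) (simp add: vec_eq_iff forall_2)
  next
    case False
    then show ?thesis
      using det by (intro that[of "l $ 1 / L $ 1"]) (simp add: vec_eq_iff forall_2 field_simps)
  qed
  have "l = Re c *\<^sub>R L + Im c *\<^sub>R (\<i> *s L)"
    unfolding c by (simp add: vec_eq_iff complex_eq_iff)
  then show ?thesis by (rule that)
qed

text \<open>The estimate 2uv \<le> u^2 / C + C v^2, applied to the mixed terms.\<close>

lemma mixed_term_bound:
  fixes \<alpha> \<beta> \<kappa> C h r s x y :: real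
  assumes "C > 0" "\<alpha>\<^sup>2 + \<beta>\<^sup>2 \<le> C * h" "\<bar>\<kappa>\<bar> \<le> K"
  shows "(r\<^sup>2 + s\<^sup>2) * h + 2 * y * (r * \<alpha> + s * \<beta>) + 2 * x * (r * \<beta> - s * \<alpha>) + (x\<^sup>2 + y\<^sup>2) * \<kappa>
    \<ge> - (C + K) * (x\<^sup>2 + y\<^sup>2)"
proof -
  \<comment> \<open>The coefficient pairs \<open>(r, s)\<close> and \<open>(-s, r)\<close> are
    orthogonal and of equal length, so adding the two squares cancels the terms with
    \<open>\<alpha> * \<beta>\<close>.\<close>
  have "0 \<le> (r * \<alpha> + s * \<beta> + C * y)\<^sup>2 + (r * \<beta> - s * \<alpha> + C * x)\<^sup>2"
    by simp
  also have "\<dots> = (r\<^sup>2 + s\<^sup>2) * (\<alpha>\<^sup>2 + \<beta>\<^sup>2)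
      + C * (2 * y * (r * \<alpha> + s * \<beta>) + 2 * x * (r * \<beta> - s * \<alpha>) + C * (x\<^sup>2 + y\<^sup>2))"
    by algebra
  also have "\<dots> \<le> (r\<^sup>2 + s\<^sup>2) * (C * h)
      + C * (2 * y * (r * \<alpha> + s * \<beta>) + 2 * x * (r * \<beta> - s * \<alpha>) + C * (x\<^sup>2 + y\<^sup>2))"
    using assms(2) by (intro add_right_mono mult_left_mono) auto
  also have "\<dots> = C * ((r\<^sup>2 + s\<^sup>2) * h + 2 * y * (r * \<alpha> + s * \<beta>) + 2 * x * (r * \<beta> - s * \<alpha>) + C * (x\<^sup>2 + y\<^sup>2))"
    by algebra
  finally have "0 \<le> (r\<^sup>2 + s\<^sup>2) * h + 2 * y * (r * \<alpha> + s * \<beta>) + 2 * x * (r * \<beta> - s * \<alpha>) + C * (x\<^sup>2 + y\<^sup>2)"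
    using assms(1) by (simp add: zero_le_mult_iff)
  moreover have "(x\<^sup>2 + y\<^sup>2) * \<kappa> \<ge> (x\<^sup>2 + y\<^sup>2) * (- K)"
    using assms(3) by (intro mult_left_mono) auto
  ultimately show ?thesis
    by (simp add: algebra_simps)
qed

context
  fixes S :: "C2 \<Rightarrow> C2"
  assumes lin: "linear S" and sym: "\<And>v w. S v \<bullet> w = v \<bullet> S w"
begin

text \<open>The operator \<open>S\<close> stands for the Hessian of the distance at a boundary
  point; separating \<open>levi\<close> from it reduces the estimate to linear algebra.\<close>

definition qf :: "C2 \<Rightarrow> real"
  where "qf a = S a \<bullet> a + S (\<i> *s a) \<bullet> (\<i> *s a)"

lemmas S_simps = linear_add[OF lin] linear_diff[OF lin] linear_cmul[OF lin] linear_neg[OF lin]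

text \<open>\<open>qf\<close> is invariant under multiplication by \<open>\<i>\<close>, hence a
  Hermitian form, and scales with the squared modulus of the complex factor
  \<open>r + \<i> s\<close>.\<close>

lemma qf_line: "qf (r *\<^sub>R L + s *\<^sub>R (\<i> *s L)) = (r\<^sup>2 + s\<^sup>2) * qf L"
  using sym[of L "\<i> *s L"]
  by (simp add: qf_def S_simps J_simps(1,7-10) inner_add_left inner_add_right inner_diff_left inner_diff_right
      inner_commute power2_eq_square algebra_simps)

text \<open>Decompose \<open>a\<close> into a vector on the complex tangent line and real multiples
  of \<open>\<nu>\<close> and \<open>\<i> *s \<nu>\<close>. As \<open>S\<close> kills
  \<open>\<nu>\<close>, there remain the Levi form on the line, its pairing with
  \<open>\<i> *s \<nu>\<close>, and one scalar bounded by \<open>K\<close>.\<close>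

lemma qf_lower_bound:
  assumes \<nu>: "norm \<nu> = 1" "S \<nu> = 0"
    and L: "L \<noteq> 0" "\<nu> \<bullet> L = 0" "\<nu> \<bullet> (\<i> *s L) = 0"
    and C: "C > 0" "(S L \<bullet> (\<i> *s \<nu>))\<^sup>2 + (S (\<i> *s L) \<bullet> (\<i> *s \<nu>))\<^sup>2 \<le> C * qf L"
    and K: "\<bar>S (\<i> *s \<nu>) \<bullet> (\<i> *s \<nu>)\<bar> \<le> K"
  shows "qf a \<ge> - (C + K) * ((\<nu> \<bullet> a)\<^sup>2 + (\<nu> \<bullet> (\<i> *s a))\<^sup>2)"
proof -
  define x where "x = \<nu> \<bullet> a"
  \<comment> \<open>The sign makes \<open>y\<close> the component along
    \<open>\<i> *s \<nu>\<close>, because multiplication by \<open>\<i>\<close> is skew.\<close>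
  define y where "y = - (\<nu> \<bullet> (\<i> *s a))"
  define l where "l = a - x *\<^sub>R \<nu> - y *\<^sub>R (\<i> *s \<nu>)"
  have "\<nu> \<noteq> 0" "\<nu> \<bullet> \<nu> = 1"
    using \<nu>(1) by (auto simp: dot_square_norm)
  moreover have "\<nu> \<bullet> l = 0" "\<nu> \<bullet> (\<i> *s l) = 0"
    using \<open>\<nu> \<bullet> \<nu> = 1\<close> by (simp_all add: l_def x_def y_def inner_diff_right inner_add_right J_simps)
  ultimately obtain r s where l: "l = r *\<^sub>R L + s *\<^sub>R (\<i> *s L)"
    using complex_line[of \<nu> L l] L by blast
  have a: "a = l + x *\<^sub>R \<nu> + y *\<^sub>R (\<i> *s \<nu>)"
    by (simp add: l_def)
  have S\<nu>: "S v \<bullet> \<nu> = 0" for v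
    using sym[of v \<nu>] \<nu>(2) by simp
  let ?\<kappa> = "S (\<i> *s \<nu>) \<bullet> (\<i> *s \<nu>)"
  have c: "S (\<i> *s \<nu>) \<bullet> v = S v \<bullet> (\<i> *s \<nu>)" for v
    using sym[of "\<i> *s \<nu>" v] by (simp add: inner_commute)
  have "qf a = qf l + 2 * y * (S l \<bullet> (\<i> *s \<nu>)) + 2 * x * (S (\<i> *s l) \<bullet> (\<i> *s \<nu>)) + (x\<^sup>2 + y\<^sup>2) * ?\<kappa>"
    unfolding a using c[of l] c[of "\<i> *s l"]
    by (simp add: qf_def S_simps J_simps(1,7-10) \<nu>(2) S\<nu> inner_add_left inner_add_right inner_diff_left
        inner_diff_right power2_eq_square algebra_simps)
  also have "S l \<bullet> (\<i> *s \<nu>) = r * (S L \<bullet> (\<i> *s \<nu>)) + s * (S (\<i> *s L) \<bullet> (\<i> *s \<nu>))"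
    unfolding l by (simp add: S_simps inner_add_left)
  also have "S (\<i> *s l) \<bullet> (\<i> *s \<nu>) = r * (S (\<i> *s L) \<bullet> (\<i> *s \<nu>)) - s * (S L \<bullet> (\<i> *s \<nu>))"
    unfolding l by (simp add: S_simps inner_add_left J_simps(1,7-10) inner_diff_left)
  also have "qf l = (r\<^sup>2 + s\<^sup>2) * qf L"
    unfolding l by (rule qf_line)
  finally show ?thesis
    using mixed_term_bound[OF C K, where r = r and s = s and x = x and y = y] by (simp add: x_def y_def)
qed

end

section \<open>The Hessian of a distance function\<close>

context
  fixes W :: "'a::euclidean_space set" and d :: "'a \<Rightarrow> real"
  assumes W: "open W" and sm: "smooth_on W d" and norm1: "\<And>q. q \<in> W \<Longrightarrow> norm (grad d q) = 1"
    and foot: "\<And>q. q \<in> W \<Longrightarrow> q - d q *\<^sub>R grad d q \<in> W"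
    and grad_foot: "\<And>q. q \<in> W \<Longrightarrow> grad d (q - d q *\<^sub>R grad d q) = grad d q"
begin

lemma hess_has_derivative:
  "q \<in> W \<Longrightarrow> (grad d has_derivative (\<lambda>v. dir_deriv (grad d) v q)) (at q)"
  by (rule smooth_on_has_derivative[OF smooth_on_grad[OF W sm]])

text \<open>This is the derivative of the eikonal equation \<open>norm (grad d q) = 1\<close>;
  symmetry of the Hessian then turns it into \<open>hess_grad\<close>.\<close>

lemma hess_grad_inner:
  assumes "q \<in> W"
  shows "dir_deriv (grad d) v q \<bullet> grad d q = 0"
proof -
  note D = hess_has_derivative[OF assms]
  have "((\<lambda>q. grad d q \<bullet> grad d q) has_derivative
      (\<lambda>v. grad d q \<bullet> dir_deriv (grad d) v q + dir_deriv (grad d) v q \<bullet> grad d q)) (at q)"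
    by (rule has_derivative_inner[OF D D])
  moreover have "((\<lambda>q. grad d q \<bullet> grad d q) has_derivative (\<lambda>v. 0)) (at q)"
    by (rule has_derivative_transform_within_open[OF has_derivative_const[of 1] W assms])
      (use norm1 in \<open>simp add: dot_square_norm\<close>)
  ultimately have "(\<lambda>v. grad d q \<bullet> dir_deriv (grad d) v q + dir_deriv (grad d) v q \<bullet> grad d q) = (\<lambda>v. 0)"
    by (rule has_derivative_unique)
  from fun_cong[OF this, of v] show ?thesis
    by (simp add: inner_commute)
qed

lemma hess_grad:
  assumes "q \<in> W"
  shows "dir_deriv (grad d) (grad d q) q = 0"
proof -
  have "dir_deriv (grad d) (grad d q) q \<bullet> dir_deriv (grad d) (grad d q) q = 0"
    using dir_deriv_grad_sym[OF W sm assms, of "grad d q"] hess_grad_inner[OF assms]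
    by (metis inner_commute)
  then show ?thesis by simp
qed

lemma foot_has_derivative:
  assumes "q \<in> W"
  shows "((\<lambda>q. q - d q *\<^sub>R grad d q) has_derivative
    (\<lambda>v. v - (d q *\<^sub>R dir_deriv (grad d) v q + (grad d q \<bullet> v) *\<^sub>R grad d q))) (at q)"
  by (intro has_derivative_diff has_derivative_ident has_derivative_scaleR hess_has_derivative
      has_derivative_grad smooth_on_differentiable[OF sm] assms)

text \<open>Differentiate \<open>grad_foot\<close>. The derivative of the foot map also contains the
  normal component of \<open>v\<close>, but the Hessian at \<open>p\<close> annihilates the normal,
  which is the same at \<open>p\<close> and \<open>q\<close>.\<close>

lemma hess_foot:
  assumes "q \<in> W"
  defines "p \<equiv> q - d q *\<^sub>R grad d q"
  shows "dir_deriv (grad d) v q = dir_deriv (grad d) v p - d q *\<^sub>R dir_deriv (grad d) (dir_deriv (grad d) v q) p"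
proof -
  have "p \<in> W" "grad d p = grad d q"
    using foot grad_foot assms by auto
  note lin = linear_dir_deriv_grad[OF W sm \<open>p \<in> W\<close>]
  have "((\<lambda>q. grad d (q - d q *\<^sub>R grad d q)) has_derivative
      (\<lambda>v. dir_deriv (grad d) (v - (d q *\<^sub>R dir_deriv (grad d) v q + (grad d q \<bullet> v) *\<^sub>R grad d q)) p)) (at q)"
    using has_derivative_compose[OF foot_has_derivative[OF assms(1)]] hess_has_derivative[OF \<open>p \<in> W\<close>]
    unfolding p_def by blast
  then have "dir_deriv (grad d) (v - (d q *\<^sub>R dir_deriv (grad d) v q + (grad d q \<bullet> v) *\<^sub>R grad d q)) p
      = dir_deriv (\<lambda>q. grad d (q - d q *\<^sub>R grad d q)) v q"
    by (simp add: dir_deriv_eq)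
  also have "\<dots> = dir_deriv (grad d) v q"
    by (rule dir_deriv_local[OF W assms(1)]) (rule grad_foot)
  finally show ?thesis
    using hess_grad[OF \<open>p \<in> W\<close>] \<open>grad d p = grad d q\<close>
    by (simp add: linear_diff[OF lin] linear_add[OF lin] linear_cmul[OF lin])
qed

text \<open>In the inward direction the Hessian of the distance solves a Riccati equation with nonnegative
  right-hand side, so it can only increase.  Here this appears without the flow, as the
  identity \<open>Q(q) = Q(p) (1 - t Q(p))\<inverse>\<close>, which is \<open>hess_foot\<close>.\<close>

lemma hess_foot_mono:
  assumes "q \<in> W" "d q \<le> 0" "\<bar>d q\<bar> * B \<le> 1"
  defines "p \<equiv> q - d q *\<^sub>R grad d q"
  assumes B: "\<And>w. norm (dir_deriv (grad d) w p) \<le> B * norm w"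
  shows "dir_deriv (grad d) v p \<bullet> v \<le> dir_deriv (grad d) v q \<bullet> v"
proof -
  have "p \<in> W" using foot assms by auto
  define w where "w = dir_deriv (grad d) v q"
  define u where "u = dir_deriv (grad d) v p"
  define t where "t = - d q"
  have w: "w = u + t *\<^sub>R dir_deriv (grad d) w p"
    using hess_foot[OF assms(1), of v] by (simp add: w_def u_def t_def p_def)
  \<comment> \<open>The bound on \<open>\<bar>d q\<bar> * B\<close> makes 1 - t Q(p) nonnegative.
    Testing this on w = Q(q) v gives \<open>u \<bullet> w \<ge> 0\<close>; by symmetry, t times this
    number is the increment of the Hessian, so nothing has to be inverted.\<close>
  have "dir_deriv (grad d) w p \<bullet> w \<le> norm (dir_deriv (grad d) w p) * norm w"
    by (rule norm_cauchy_schwarz)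
  also have "\<dots> \<le> B * norm w * norm w"
    by (intro mult_right_mono B) simp
  finally have "t * (dir_deriv (grad d) w p \<bullet> w) \<le> t * B * (norm w)\<^sup>2"
    using assms(2) by (simp add: t_def power2_eq_square mult_left_mono_neg mult.assoc)
  also have "\<dots> \<le> 1 * (norm w)\<^sup>2"
    using assms(2,3) by (intro mult_right_mono) (auto simp: t_def)
  finally have "0 \<le> w \<bullet> w - t * (dir_deriv (grad d) w p \<bullet> w)"
    by (simp add: dot_square_norm)
  also have "\<dots> = (w - t *\<^sub>R dir_deriv (grad d) w p) \<bullet> w"
    by (simp add: inner_diff_left)
  also have "\<dots> = u \<bullet> w"
    using w by (metis add_diff_cancel_right')
  also have "\<dots> = dir_deriv (grad d) w p \<bullet> v"
    using dir_deriv_grad_sym[OF W sm \<open>p \<in> W\<close>, of w v] by (simp add: u_def inner_commute)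
  finally have "0 \<le> t * (dir_deriv (grad d) w p \<bullet> v)"
    using assms(2) by (simp add: t_def mult_nonpos_nonneg)
  also have "\<dots> = w \<bullet> v - u \<bullet> v"
    by (subst (2) w) (simp add: inner_add_left)
  finally show ?thesis
    by (simp add: w_def u_def)
qed

text \<open>That \<open>grad \<rho>\<close> is normal is known only on the boundary. Composing with
  the foot map turns this into an identity on an open set and costs nothing for tangent
  \<open>v\<close>, as the foot map has the tangential projection as derivative at \<open>p\<close>.
  The derivative of the scalar factor points along the normal and disappears on pairing with
  \<open>w\<close>.\<close>

lemma hess_tangential_eq:
  assumes sm\<rho>: "smooth_on W \<rho>" and parallel: "\<And>q. q \<in> W \<Longrightarrow>
      grad \<rho> (q - d q *\<^sub>R grad d q) = norm (grad \<rho> (q - d q *\<^sub>R grad d q)) *\<^sub>R grad d q"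
    and p: "p \<in> W" "d p = 0" and v: "grad d p \<bullet> v = 0" and w: "grad d p \<bullet> w = 0"
  shows "dir_deriv (grad \<rho>) v p \<bullet> w = norm (grad \<rho> p) * (dir_deriv (grad d) v p \<bullet> w)"
proof -
  let ?f = "\<lambda>q. q - d q *\<^sub>R grad d q"
  let ?D = "\<lambda>v. dir_deriv (grad \<rho>) (v - (grad d p \<bullet> v) *\<^sub>R grad d p) p"
  have f: "(?f has_derivative (\<lambda>v. v - (grad d p \<bullet> v) *\<^sub>R grad d p)) (at p)"
    using foot_has_derivative[OF p(1)] p(2) by simp
  have "(grad \<rho> has_derivative (\<lambda>v. dir_deriv (grad \<rho>) v p)) (at (?f p))"
    using smooth_on_has_derivative[OF smooth_on_grad[OF W sm\<rho>] p(1)] p(2) by simp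
  from has_derivative_compose[OF f this]
  have lhs: "((\<lambda>q. grad \<rho> (?f q)) has_derivative ?D) (at p)" .
  \<comment> \<open>The length of \<open>grad \<rho>\<close> is written as an inner product so that
    the product rule applies.\<close>
  have "((\<lambda>q. (grad \<rho> (?f q) \<bullet> grad d q) *\<^sub>R grad d q) has_derivative
      (\<lambda>v. (grad \<rho> (?f p) \<bullet> grad d p) *\<^sub>R dir_deriv (grad d) v p
        + (grad \<rho> (?f p) \<bullet> dir_deriv (grad d) v p + ?D v \<bullet> grad d p) *\<^sub>R grad d p)) (at p)"
    by (intro has_derivative_scaleR has_derivative_inner lhs hess_has_derivative p)
  moreover have "(grad \<rho> (?f q) \<bullet> grad d q) *\<^sub>R grad d q = grad \<rho> (?f q)" if "q \<in> W" for q
  proof -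
    have "grad \<rho> (?f q) \<bullet> grad d q = norm (grad \<rho> (?f q))"
      using norm1[OF that] by (subst parallel[OF that]) (simp add: dot_square_norm)
    then show ?thesis
      using parallel[OF that] by simp
  qed
  ultimately have "((\<lambda>q. grad \<rho> (?f q)) has_derivative
      (\<lambda>v. (grad \<rho> (?f p) \<bullet> grad d p) *\<^sub>R dir_deriv (grad d) v p
        + (grad \<rho> (?f p) \<bullet> dir_deriv (grad d) v p + ?D v \<bullet> grad d p) *\<^sub>R grad d p)) (at p)"
    by (rule has_derivative_transform_within_open[OF _ W p(1)])
  from fun_cong[OF has_derivative_unique[OF lhs this], of v]
  have "dir_deriv (grad \<rho>) v p = (grad \<rho> p \<bullet> grad d p) *\<^sub>R dir_deriv (grad d) v p
        + (grad \<rho> p \<bullet> dir_deriv (grad d) v p + dir_deriv (grad \<rho>) v p \<bullet> grad d p) *\<^sub>R grad d p"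
    using v p(2) by simp
  then have "dir_deriv (grad \<rho>) v p \<bullet> w = (grad \<rho> p \<bullet> grad d p) * (dir_deriv (grad d) v p \<bullet> w)"
    using w by (metis inner_add_left inner_scaleR_left mult_zero_right add.right_neutral)
  also have "grad \<rho> p \<bullet> grad d p = norm (grad \<rho> p)"
    using parallel[OF p(1)] norm1[OF p(1)] p(2)
    by (metis diff_zero inner_scaleR_left dot_square_norm mult.right_neutral power_one scaleR_zero_left)
  finally show ?thesis .
qed

end

section \<open>Boundary estimates\<close>

lemma im_field_eq: "im_field A = - (\<i> *s A)"
  by (simp add: im_field_def vec_eq_iff)

lemma dir_deriv_cplx:
  assumes "f differentiable (at q)"
  shows "cplx f differentiable (at q)" "dir_deriv (cplx f) v q = of_real (grad f q \<bullet> v)"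
proof -
  have "(cplx f has_derivative (\<lambda>v. of_real (grad f q \<bullet> v))) (at q)"
    by (intro has_derivative_of_real has_derivative_grad assms)
  then show "cplx f differentiable (at q)" "dir_deriv (cplx f) v q = of_real (grad f q \<bullet> v)"
    by (auto simp: differentiable_def dir_deriv_eq)
qed

lemma holo_apply_eq_0_iff:
  assumes "f differentiable (at q)"
  shows "holo_apply A (cplx f) q = 0 \<longleftrightarrow> grad f q \<bullet> A = 0 \<and> grad f q \<bullet> (\<i> *s A) = 0"
  unfolding holo_apply_decomp[OF dir_deriv_cplx(1)[OF assms]] dir_deriv_cplx(2)[OF assms]
  by (simp add: re_field_def im_field_eq complex_eq_iff)

lemma inner_axis_C2: "(x :: C2) \<bullet> axis j 1 = Re (x $ j)" "(x :: C2) \<bullet> axis j \<i> = Im (x $ j)"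
  by (simp_all add: inner_axis inner_complex_def)

text \<open>The factors 1/2 in \<open>dz\<close> and \<open>dzbar\<close> cancel. Hence the real
  part of the normal field is the unit gradient, and \<open>T\<close> is minus its rotation by
  \<open>\<i>\<close>.\<close>

lemma normal_field_eq:
  assumes "f differentiable (at q)"
  shows "normal_field f q = (1 / norm (grad f q)) *\<^sub>R grad f q"
proof -
  have dzbar: "dzbar j (cplx f) q = grad f q $ j / 2" for j
    unfolding dzbar_def dir_deriv_cplx(2)[OF assms] inner_axis_C2 by (simp add: complex_eq_iff)
  have dz: "dz j (cplx f) q = cnj (grad f q $ j) / 2" for j
    unfolding dz_def dir_deriv_cplx(2)[OF assms] inner_axis_C2 by (simp add: complex_eq_iff)
  have "sqrt (\<Sum>j\<in>UNIV. (cmod (dz j (cplx f) q))\<^sup>2) = sqrt ((\<Sum>j\<in>UNIV. (cmod (grad f q $ j))\<^sup>2) / 4)"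
    by (simp add: dz norm_divide power_divide sum_divide_distrib)
  also have "\<dots> = norm (grad f q) / 2"
    by (simp add: norm_vec_def L2_set_def real_sqrt_divide)
  finally have norm_dz: "sqrt (\<Sum>j\<in>UNIV. (cmod (dz j (cplx f) q))\<^sup>2) = norm (grad f q) / 2" .
  show ?thesis
    unfolding normal_field_def norm_dz by (simp add: dzbar vec_eq_iff complex_eq_iff)
qed

text \<open>Applied to \<open>grad \<rho>\<close>, this is twice the standard tangential field with
  coefficients -rho_w and rho_z.\<close>

definition tangent_rot :: "C2 \<Rightarrow> C2"
  where "tangent_rot v = vector [- cnj (v $ 2), cnj (v $ 1)]"

lemma tangent_rot_nth: "tangent_rot v $ 1 = - cnj (v $ 2)" "tangent_rot v $ 2 = cnj (v $ 1)"
  by (simp_all add: tangent_rot_def vector_2)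

lemma tangent_rot_perp: "v \<bullet> tangent_rot v = 0" "v \<bullet> (\<i> *s tangent_rot v) = 0"
  by (simp_all add: inner_vec_def sum_2 tangent_rot_nth inner_complex_def)

lemma tangent_rot_eq_0_iff: "tangent_rot v = 0 \<longleftrightarrow> v = 0"
  by (auto simp: vec_eq_iff forall_2 tangent_rot_nth)

lemma bounded_linear_tangent_rot: "bounded_linear tangent_rot"
  unfolding linear_conv_bounded_linear[symmetric]
  by (rule linearI) (simp_all add: vec_eq_iff forall_2 tangent_rot_nth complex_eq_iff)

lemma defining_on_subset:
  "defining_on \<Omega> U \<rho> \<Longrightarrow> open V \<Longrightarrow> V \<subseteq> U \<Longrightarrow> defining_on \<Omega> V \<rho>"
  unfolding defining_on_def using smooth_on_subset by blast

lemma signed_dist_frontier: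
  "open \<Omega> \<Longrightarrow> p \<in> frontier \<Omega> \<Longrightarrow> signed_dist \<Omega> p = 0"
  by (auto simp: signed_dist_def frontier_def interior_open)

lemma levi_eq_qf:
  assumes "open W" "smooth_on W d" "p \<in> W"
  shows "levi d p a = qf (\<lambda>v. dir_deriv (grad d) v p) a"
  using qf_def[OF linear_dir_deriv_grad[OF assms] dir_deriv_grad_sym[OF assms]]
  by (simp add: levi_def)

text \<open>Pseudoconvexity and sesquiconvexity may be witnessed by different defining functions;
  this comparison carries both to the signed distance.\<close>

lemma defining_on_hess_tangential:
  fixes \<Omega> :: "C2 set"
  assumes \<Omega>: "open \<Omega>" and def: "defining_on \<Omega> U \<rho>" and p0: "p0 \<in> frontier \<Omega> \<inter> U"
  defines "d \<equiv> signed_dist \<Omega>"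
  obtains W where "open W" "p0 \<in> W" "W \<subseteq> U" "smooth_on W d"
    "\<And>p. p \<in> frontier \<Omega> \<inter> W \<Longrightarrow> norm (grad d p) = 1"
    "\<And>p. p \<in> frontier \<Omega> \<inter> W \<Longrightarrow> grad \<rho> p = norm (grad \<rho> p) *\<^sub>R grad d p"
    "\<And>p v w. p \<in> frontier \<Omega> \<inter> W \<Longrightarrow> grad d p \<bullet> v = 0 \<Longrightarrow> grad d p \<bullet> w = 0
      \<Longrightarrow> dir_deriv (grad \<rho>) v p \<bullet> w = norm (grad \<rho> p) * (dir_deriv (grad d) v p \<bullet> w)"
proof -
  have sm\<rho>: "smooth_on U \<rho>" using def by (simp add: defining_on_def)
  obtain W where W: "open W" "p0 \<in> W" "W \<subseteq> U" "smooth_on W d"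
    "\<And>q. q \<in> W \<Longrightarrow> norm (grad d q) = 1"
    "\<And>q. q \<in> W \<Longrightarrow> q - d q *\<^sub>R grad d q \<in> frontier \<Omega> \<inter> W"
    "\<And>q. q \<in> W \<Longrightarrow> grad d (q - d q *\<^sub>R grad d q) = grad d q"
    "\<And>p. p \<in> frontier \<Omega> \<inter> W \<Longrightarrow> grad \<rho> p = norm (grad \<rho> p) *\<^sub>R grad d p"
    using signed_dist_local[OF \<Omega> def p0] unfolding d_def by metis
  have "dir_deriv (grad \<rho>) v p \<bullet> w = norm (grad \<rho> p) * (dir_deriv (grad d) v p \<bullet> w)"
    if "p \<in> frontier \<Omega> \<inter> W" "grad d p \<bullet> v = 0" "grad d p \<bullet> w = 0" for p v w
  proof (rule hess_tangential_eq[OF W(1,4,5)])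
    show "grad \<rho> (q - d q *\<^sub>R grad d q) = norm (grad \<rho> (q - d q *\<^sub>R grad d q)) *\<^sub>R grad d q"
      if "q \<in> W" for q
      using W(8)[OF W(6)[OF that]] W(7)[OF that] by simp
    show "d p = 0"
      using that signed_dist_frontier[OF \<Omega>] by (simp add: d_def)
  qed (use that W sm\<rho> smooth_on_subset in blast)+
  then show ?thesis
    using that[of W] W by blast
qed

text \<open>One test field suffices: \<open>tangent_rot (grad \<rho>)\<close> has no zero on the
  boundary, so every complex tangent vector is a complex multiple of it, and \<open>qf_line\<close>
  passes the sign on.\<close>

lemma pseudoconvex_at_levi:
  fixes \<Omega> :: "C2 set"
  assumes \<Omega>: "open \<Omega>" and p0: "p0 \<in> frontier \<Omega>" and psc: "pseudoconvex_at \<Omega> p0"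
  defines "d \<equiv> signed_dist \<Omega>"
  obtains N where "open N" "p0 \<in> N"
    "\<And>p a. p \<in> frontier \<Omega> \<inter> N \<Longrightarrow> grad d p \<bullet> a = 0 \<Longrightarrow> grad d p \<bullet> (\<i> *s a) = 0 \<Longrightarrow> 0 \<le> levi d p a"
proof -
  obtain U \<rho> V where def: "defining_on \<Omega> U \<rho>" and V: "open V" "p0 \<in> V" "V \<subseteq> U"
    and H: "\<And>L q. holo_tangential \<Omega> \<rho> V L \<Longrightarrow> q \<in> frontier \<Omega> \<inter> V \<Longrightarrow> 0 \<le> complex_hessian \<rho> q (L q) (L q)"
    using psc unfolding pseudoconvex_at_def local_defining_function_def by metis
  have defV: "defining_on \<Omega> V \<rho>"
    by (rule defining_on_subset[OF def V(1,3)])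
  then have sm: "smooth_on V \<rho>" by (simp add: defining_on_def)
  define L where "L q = tangent_rot (grad \<rho> q)" for q
  have "smooth_on V L"
    unfolding L_def[abs_def]
    by (rule smooth_on_linear[OF V(1) bounded_linear_tangent_rot smooth_on_grad[OF V(1) sm]])
  then have "holo_tangential \<Omega> \<rho> V L"
    using smooth_on_differentiable[OF sm]
    by (auto simp: holo_tangential_def holo_apply_eq_0_iff L_def tangent_rot_perp)
  have leviL: "0 \<le> levi \<rho> q (L q)" if "q \<in> frontier \<Omega> \<inter> V" for q
  proof -
    have "q \<in> V" using that by simp
    show ?thesis
      using H[OF \<open>holo_tangential \<Omega> \<rho> V L\<close> that]
      unfolding complex_hessian_eq_levi[OF V(1) sm \<open>q \<in> V\<close>] less_eq_complex_def by simp
  qed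
  have "p0 \<in> frontier \<Omega> \<inter> V" using p0 V by simp
  from defining_on_hess_tangential[OF \<Omega> defV this]
  obtain W where W: "open W" "p0 \<in> W" "W \<subseteq> V" "smooth_on W d"
    "\<And>p. p \<in> frontier \<Omega> \<inter> W \<Longrightarrow> norm (grad d p) = 1"
    "\<And>p. p \<in> frontier \<Omega> \<inter> W \<Longrightarrow> grad \<rho> p = norm (grad \<rho> p) *\<^sub>R grad d p"
    "\<And>p v w. p \<in> frontier \<Omega> \<inter> W \<Longrightarrow> grad d p \<bullet> v = 0 \<Longrightarrow> grad d p \<bullet> w = 0
      \<Longrightarrow> dir_deriv (grad \<rho>) v p \<bullet> w = norm (grad \<rho> p) * (dir_deriv (grad d) v p \<bullet> w)"
    unfolding d_def by metis
  have "0 \<le> levi d p a" if p: "p \<in> frontier \<Omega> \<inter> W" and a: "grad d p \<bullet> a = 0" "grad d p \<bullet> (\<i> *s a) = 0" for p a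
  proof -
    have pV: "p \<in> frontier \<Omega> \<inter> V" using p W(3) by auto
    have g: "norm (grad \<rho> p) > 0"
      using defining_on_grad_nonzero[OF defV pV] by simp
    have nz: "grad d p \<noteq> 0" "L p \<noteq> 0"
      using W(5)[OF p] g by (auto simp: L_def tangent_rot_eq_0_iff)
    have "norm (grad \<rho> p) * (grad d p \<bullet> L p) = 0" "norm (grad \<rho> p) * (grad d p \<bullet> (\<i> *s L p)) = 0"
      using tangent_rot_perp[of "grad \<rho> p"] arg_cong[OF W(6)[OF p], of "\<lambda>y. y \<bullet> x" for x]
      unfolding L_def by simp_all
    then have Lp: "grad d p \<bullet> L p = 0" "grad d p \<bullet> (\<i> *s L p) = 0"
      using g by auto
    have "levi \<rho> p (L p) = norm (grad \<rho> p) * levi d p (L p)"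
      unfolding levi_def using W(7)[OF p] Lp by (simp add: distrib_left)
    then have "0 \<le> levi d p (L p)"
      using leviL[OF pV] g by (simp add: zero_le_mult_iff)
    moreover obtain r s where rs: "a = r *\<^sub>R L p + s *\<^sub>R (\<i> *s L p)"
      using complex_line[OF nz Lp a] .
    moreover have "levi d p (r *\<^sub>R L p + s *\<^sub>R (\<i> *s L p)) = (r\<^sup>2 + s\<^sup>2) * levi d p (L p)"
    proof -
      have "p \<in> W" using p by simp
      note Wp = W(1,4) this
      show ?thesis
        unfolding levi_eq_qf[OF Wp]
        by (rule qf_line[OF linear_dir_deriv_grad[OF Wp] dir_deriv_grad_sym[OF Wp]])
    qed
    ultimately show ?thesis by simp
  qed
  then show ?thesis
    using that[OF W(1,2)] by blast
qed

text \<open>Pseudoconvexity identifies the absolute value in the O-condition with the Levi form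
  itself. Under the passage from \<open>\<rho>\<close> to \<open>d\<close> the left side scales with
  the square of \<open>norm (grad \<rho> p)\<close> and the right side linearly, so a lower bound of
  this norm enters the constant.\<close>

lemma sesquiconvex_at_mixed_bound:
  fixes \<Omega> :: "C2 set"
  assumes \<Omega>: "open \<Omega>" and p0: "p0 \<in> frontier \<Omega>" and sesq: "sesquiconvex_at \<Omega> p0"
  defines "d \<equiv> signed_dist \<Omega>"
  obtains N C where "open N" "p0 \<in> N" "C > 0"
    "\<And>p. p \<in> frontier \<Omega> \<inter> N \<Longrightarrow> \<exists>L. L \<noteq> 0 \<and> grad d p \<bullet> L = 0 \<and> grad d p \<bullet> (\<i> *s L) = 0 \<and> 0 \<le> levi d p L \<and>
      (dir_deriv (grad d) L p \<bullet> (\<i> *s grad d p))\<^sup>2 + (dir_deriv (grad d) (\<i> *s L) p \<bullet> (\<i> *s grad d p))\<^sup>2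
        \<le> C * levi d p L"
proof -
  have "pseudoconvex_at \<Omega> p0"
    using sesq by (simp add: sesquiconvex_at_def)
  from pseudoconvex_at_levi[OF \<Omega> p0 this]
  obtain N1 where N1: "open N1" "p0 \<in> N1"
    "\<And>p a. p \<in> frontier \<Omega> \<inter> N1 \<Longrightarrow> grad d p \<bullet> a = 0 \<Longrightarrow> grad d p \<bullet> (\<i> *s a) = 0 \<Longrightarrow> 0 \<le> levi d p a"
    unfolding d_def by metis
  obtain U \<rho> L where def: "defining_on \<Omega> U \<rho>" and "p0 \<in> U" and hol: "holo_tangential \<Omega> \<rho> U L"
    and L: "\<And>q. q \<in> U \<Longrightarrow> L q \<noteq> 0"
    and O: "big_O_on (frontier \<Omega> \<inter> U)
      (\<lambda>q. (real_hessian \<rho> q (im_field (L q)) (im_field (normal_field \<rho> q)))\<^sup>2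
         + (real_hessian \<rho> q (re_field (L q)) (im_field (normal_field \<rho> q)))\<^sup>2)
      (\<lambda>q. complex_hessian \<rho> q (L q) (L q))"
    using sesq unfolding sesquiconvex_at_def local_defining_function_def Let_def by blast
  have U: "open U" "smooth_on U \<rho>"
    using def by (auto simp: defining_on_def)
  have "p0 \<in> frontier \<Omega> \<inter> U" using p0 \<open>p0 \<in> U\<close> by simp
  from defining_on_hess_tangential[OF \<Omega> def this]
  obtain W where W: "open W" "p0 \<in> W" "W \<subseteq> U" "smooth_on W d"
    "\<And>p. p \<in> frontier \<Omega> \<inter> W \<Longrightarrow> norm (grad d p) = 1"
    "\<And>p. p \<in> frontier \<Omega> \<inter> W \<Longrightarrow> grad \<rho> p = norm (grad \<rho> p) *\<^sub>R grad d p"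
    "\<And>p v w. p \<in> frontier \<Omega> \<inter> W \<Longrightarrow> grad d p \<bullet> v = 0 \<Longrightarrow> grad d p \<bullet> w = 0
      \<Longrightarrow> dir_deriv (grad \<rho>) v p \<bullet> w = norm (grad \<rho> p) * (dir_deriv (grad d) v p \<bullet> w)"
    unfolding d_def by metis
  have "open (W \<inter> N1)" "p0 \<in> W \<inter> N1" using W N1 by auto
  then obtain r where r: "r > 0" "cball p0 r \<subseteq> W \<inter> N1"
    using open_contains_cball by blast
  define K where "K = frontier \<Omega> \<inter> cball p0 r"
  have K: "compact K" "p0 \<in> K" "K \<subseteq> frontier \<Omega> \<inter> W" "K \<subseteq> frontier \<Omega> \<inter> U" "K \<subseteq> frontier \<Omega> \<inter> N1"
    unfolding K_def using r p0 W(3) by (auto intro: closed_Int_compact)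
  obtain C0 where C0: "C0 > 0" "\<And>q. q \<in> K \<Longrightarrow>
      (real_hessian \<rho> q (im_field (L q)) (im_field (normal_field \<rho> q)))\<^sup>2
         + (real_hessian \<rho> q (re_field (L q)) (im_field (normal_field \<rho> q)))\<^sup>2
      \<le> C0 * norm (complex_hessian \<rho> q (L q) (L q))"
  proof -
    have "compact (closure K) \<and> closure K \<subseteq> frontier \<Omega> \<inter> U"
      using K(1,4) by (simp add: compact_imp_closed)
    from O[unfolded big_O_on_def, rule_format, OF this]
    obtain C0 where "C0 > 0" and C0: "\<And>q. q \<in> K \<Longrightarrow>
      norm ((real_hessian \<rho> q (im_field (L q)) (im_field (normal_field \<rho> q)))\<^sup>2
         + (real_hessian \<rho> q (re_field (L q)) (im_field (normal_field \<rho> q)))\<^sup>2)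
      \<le> C0 * norm (complex_hessian \<rho> q (L q) (L q))"
      by blast
    show ?thesis
      by (rule that[OF \<open>C0 > 0\<close>], rule order_trans[OF _ C0], simp_all)
  qed
  obtain m where m: "m > 0" "\<And>q. q \<in> K \<Longrightarrow> m \<le> norm (grad \<rho> q)"
  proof -
    have "continuous_on K (\<lambda>q. norm (grad \<rho> q))"
      using K(4) by (auto intro: continuous_on_norm[OF continuous_on_subset[OF
            smooth_on_continuous_on[OF smooth_on_grad[OF U]]]])
    then obtain x where "x \<in> K" "\<And>q. q \<in> K \<Longrightarrow> norm (grad \<rho> x) \<le> norm (grad \<rho> q)"
      using continuous_attains_inf[OF K(1)] K(2) by (metis empty_iff)
    then show ?thesis
      using that[of "norm (grad \<rho> x)"] defining_on_grad_nonzero[OF def, of x] K(4) by auto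
  qed
  \<comment> \<open>The 4 comes from \<open>complex_hessian_eq_levi\<close>, and \<open>m\<close>
    bounds from below the one factor \<open>g\<close> left after cancelling.\<close>
  define C where "C = C0 / (4 * m)"
  show ?thesis
  proof (rule that[of "ball p0 r" C])
    show "C > 0" using C0 m by (simp add: C_def)
    fix p assume "p \<in> frontier \<Omega> \<inter> ball p0 r"
    then have "p \<in> K" by (auto simp: K_def)
    then have p: "p \<in> frontier \<Omega> \<inter> W" "p \<in> frontier \<Omega> \<inter> U" "p \<in> frontier \<Omega> \<inter> N1" "p \<in> U"
      using K by auto
    define \<nu> where "\<nu> = grad d p"
    define g where "g = norm (grad \<rho> p)"
    have g: "g \<ge> m" "g > 0"
      using m(2)[of p] m(1) \<open>p \<in> K\<close> by (auto simp: g_def)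
    have diff: "\<rho> differentiable (at p)"
      by (rule smooth_on_differentiable[OF U(2) p(4)])
    have g\<nu>: "grad \<rho> p = g *\<^sub>R \<nu>"
      using W(6)[OF p(1)] by (simp add: g_def \<nu>_def)
    have L\<nu>: "\<nu> \<bullet> L p = 0" "\<nu> \<bullet> (\<i> *s L p) = 0"
      using hol p(2) g holo_apply_eq_0_iff[OF diff] by (auto simp: holo_tangential_def g\<nu>)
    have J\<nu>: "\<nu> \<bullet> (\<i> *s \<nu>) = 0"
      by (rule J_simps)
    note hess = W(7)[OF p(1), folded \<nu>_def g_def]
    have nf: "normal_field \<rho> p = \<nu>"
      using g by (simp add: normal_field_eq[OF diff] flip: g_def) (simp add: g\<nu>)
    have "(real_hessian \<rho> p (im_field (L p)) (im_field (normal_field \<rho> p)))\<^sup>2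
         + (real_hessian \<rho> p (re_field (L p)) (im_field (normal_field \<rho> p)))\<^sup>2
      = (dir_deriv (grad \<rho>) (\<i> *s L p) p \<bullet> (\<i> *s \<nu>))\<^sup>2 + (dir_deriv (grad \<rho>) (L p) p \<bullet> (\<i> *s \<nu>))\<^sup>2"
      unfolding real_hessian_eq[OF U p(4)] nf im_field_eq re_field_def
      using linear_neg[OF linear_dir_deriv_grad[OF U p(4)]] by simp
    also have "\<dots> = g\<^sup>2 * ((dir_deriv (grad d) (L p) p \<bullet> (\<i> *s \<nu>))\<^sup>2
        + (dir_deriv (grad d) (\<i> *s L p) p \<bullet> (\<i> *s \<nu>))\<^sup>2)"
      using hess L\<nu> J\<nu> by (simp add: algebra_simps power_mult_distrib)
    finally have lhs: "g\<^sup>2 * ((dir_deriv (grad d) (L p) p \<bullet> (\<i> *s \<nu>))\<^sup>2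
        + (dir_deriv (grad d) (\<i> *s L p) p \<bullet> (\<i> *s \<nu>))\<^sup>2) \<le> C0 * norm (complex_hessian \<rho> p (L p) (L p))"
      using C0(2)[OF \<open>p \<in> K\<close>] by simp
    have levi: "0 \<le> levi d p (L p)"
      using N1(3)[OF p(3)] L\<nu> by (simp add: \<nu>_def)
    have "levi \<rho> p (L p) = g * levi d p (L p)"
      unfolding levi_def using hess L\<nu> by (simp add: distrib_left)
    then have "norm (complex_hessian \<rho> p (L p) (L p)) = g * levi d p (L p) / 4"
      unfolding complex_hessian_eq_levi[OF U p(4)] norm_of_real using levi g by simp
    with lhs have "g * (g * ((dir_deriv (grad d) (L p) p \<bullet> (\<i> *s \<nu>))\<^sup>2
        + (dir_deriv (grad d) (\<i> *s L p) p \<bullet> (\<i> *s \<nu>))\<^sup>2)) \<le> g * (C0 / 4 * levi d p (L p))"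
      by (simp add: power2_eq_square algebra_simps)
    then have "g * ((dir_deriv (grad d) (L p) p \<bullet> (\<i> *s \<nu>))\<^sup>2
        + (dir_deriv (grad d) (\<i> *s L p) p \<bullet> (\<i> *s \<nu>))\<^sup>2) \<le> C0 / 4 * levi d p (L p)"
      using g(2) by (rule mult_left_le_imp_le)
    moreover have "m * ((dir_deriv (grad d) (L p) p \<bullet> (\<i> *s \<nu>))\<^sup>2
        + (dir_deriv (grad d) (\<i> *s L p) p \<bullet> (\<i> *s \<nu>))\<^sup>2) \<le> g * ((dir_deriv (grad d) (L p) p \<bullet> (\<i> *s \<nu>))\<^sup>2
        + (dir_deriv (grad d) (\<i> *s L p) p \<bullet> (\<i> *s \<nu>))\<^sup>2)"
      by (rule mult_right_mono[OF g(1)]) simp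
    ultimately have "(dir_deriv (grad d) (L p) p \<bullet> (\<i> *s \<nu>))\<^sup>2
        + (dir_deriv (grad d) (\<i> *s L p) p \<bullet> (\<i> *s \<nu>))\<^sup>2 \<le> C * levi d p (L p)"
      using m(1) by (simp add: C_def field_simps)
    then show "\<exists>L. L \<noteq> 0 \<and> grad d p \<bullet> L = 0 \<and> grad d p \<bullet> (\<i> *s L) = 0 \<and> 0 \<le> levi d p L \<and>
      (dir_deriv (grad d) L p \<bullet> (\<i> *s grad d p))\<^sup>2 + (dir_deriv (grad d) (\<i> *s L) p \<bullet> (\<i> *s grad d p))\<^sup>2
        \<le> C * levi d p L"
      using L[OF p(4)] L\<nu> levi unfolding \<nu>_def by blast
  qed (use r in auto)
qed

text \<open>Compactness is applied only to the finitely many basis vectors, so continuity for each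
  fixed vector is enough.\<close>

lemma linear_family_bounded:
  fixes A :: "'a::topological_space \<Rightarrow> 'b::euclidean_space \<Rightarrow> 'c::real_normed_vector"
  assumes "compact K" "\<And>p. p \<in> K \<Longrightarrow> linear (A p)" "\<And>v. continuous_on K (\<lambda>p. A p v)"
  obtains B where "B \<ge> 0" "\<And>p v. p \<in> K \<Longrightarrow> norm (A p v) \<le> B * norm v"
proof -
  have "\<exists>B\<ge>0. \<forall>p\<in>K. norm (A p b) \<le> B" for b
    using compact_imp_bounded[OF compact_continuous_image[OF assms(3,1)], of b]
    unfolding bounded_pos by (auto intro: less_imp_le)
  then obtain B where B: "\<And>b. B b \<ge> 0" "\<And>b p. p \<in> K \<Longrightarrow> norm (A p b) \<le> B b"
    by metis
  have "norm (A p v) \<le> (\<Sum>b\<in>Basis. B b) * norm v" if "p \<in> K" for p v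
  proof -
    have "norm (A p v) = norm (\<Sum>b\<in>Basis. (v \<bullet> b) *\<^sub>R A p b)"
      using linear_sum_Basis[OF assms(2)[OF that], of v] by simp
    also have "\<dots> \<le> (\<Sum>b\<in>Basis. norm v * B b)"
      by (rule sum_norm_le) (auto intro!: mult_mono B that Basis_le_norm)
    finally show ?thesis
      by (simp add: sum_distrib_left mult.commute)
  qed
  then show ?thesis
    using that[of "\<Sum>b\<in>Basis. B b"] B(1) by (simp add: sum_nonneg)
qed

section \<open>The plurisubharmonic defining function\<close>

text \<open>The inequality survives enlarging \<open>C\<close> because
  \<open>0 \<le> levi d p L\<close> is carried along with it; a finite subcover then gives a uniform
  constant.\<close>

lemma sesquiconvex_mixed_bound:
  fixes \<Omega> :: "C2 set"
  assumes \<Omega>: "open \<Omega>" "bounded \<Omega>" and sesq: "sesquiconvex \<Omega>"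
  defines "d \<equiv> signed_dist \<Omega>"
  obtains C where "C > 0"
    "\<And>p. p \<in> frontier \<Omega> \<Longrightarrow> \<exists>L. L \<noteq> 0 \<and> grad d p \<bullet> L = 0 \<and> grad d p \<bullet> (\<i> *s L) = 0 \<and> 0 \<le> levi d p L \<and>
      (dir_deriv (grad d) L p \<bullet> (\<i> *s grad d p))\<^sup>2 + (dir_deriv (grad d) (\<i> *s L) p \<bullet> (\<i> *s grad d p))\<^sup>2
        \<le> C * levi d p L"
proof -
  define P where "P C p \<longleftrightarrow> (\<exists>L. L \<noteq> 0 \<and> grad d p \<bullet> L = 0 \<and> grad d p \<bullet> (\<i> *s L) = 0 \<and> 0 \<le> levi d p L \<and>
      (dir_deriv (grad d) L p \<bullet> (\<i> *s grad d p))\<^sup>2 + (dir_deriv (grad d) (\<i> *s L) p \<bullet> (\<i> *s grad d p))\<^sup>2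
        \<le> C * levi d p L)" for C :: real and p
  have mono: "P C' p" if "P C p" "C \<le> C'" for C C' p
    using that unfolding P_def by (meson mult_right_mono order_trans)
  have "\<exists>N C. open N \<and> p0 \<in> N \<and> C > 0 \<and> (\<forall>p\<in>frontier \<Omega> \<inter> N. P C p)" if p0: "p0 \<in> frontier \<Omega>" for p0
  proof -
    have "sesquiconvex_at \<Omega> p0"
      using sesq p0 by (simp add: sesquiconvex_def)
    from sesquiconvex_at_mixed_bound[OF \<Omega>(1) p0 this]
    show ?thesis
      unfolding P_def d_def by metis
  qed
  then obtain N C where N: "\<And>p0. p0 \<in> frontier \<Omega> \<Longrightarrow>
      open (N p0) \<and> p0 \<in> N p0 \<and> C p0 > (0::real) \<and> (\<forall>p\<in>frontier \<Omega> \<inter> N p0. P (C p0) p)"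
    by metis
  have "compact (frontier \<Omega>)"
    by (rule compact_frontier_bounded[OF \<Omega>(2)])
  then obtain F where F: "F \<subseteq> frontier \<Omega>" "finite F" "frontier \<Omega> \<subseteq> (\<Union>p\<in>F. N p)"
    by (rule compactE_image[of "frontier \<Omega>" "frontier \<Omega>" N]) (use N in auto)
  have le: "C p \<le> (\<Sum>p\<in>F. C p)" if "p \<in> F" for p
    using N F that by (intro member_le_sum) (auto intro: less_imp_le)
  \<comment> \<open>The sum dominates every local constant, and the summand 1 keeps the result
    positive even for empty \<open>F\<close>.\<close>
  have "P (1 + (\<Sum>p\<in>F. C p)) p" if p: "p \<in> frontier \<Omega>" for p
  proof -
    obtain p0 where "p0 \<in> F" "p \<in> N p0" using F(3) p by blast
    then show ?thesis
      using N[of p0] F(1) p le[of p0] mono[of "C p0" p "1 + (\<Sum>p\<in>F. C p)"] by auto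
  qed
  moreover have "0 \<le> (\<Sum>p\<in>F. C p)"
    using N F by (intro sum_nonneg) (auto intro: less_imp_le)
  ultimately show ?thesis
    using that[of "1 + (\<Sum>p\<in>F. C p)"] unfolding P_def by simp
qed

text \<open>\<open>infdist\<close> to the empty set is 0 by convention, so the sign carries
  information only if there is a frontier point.\<close>

lemma signed_dist_neg_iff:
  assumes "open \<Omega>" "frontier \<Omega> \<noteq> {}"
  shows "signed_dist \<Omega> q < 0 \<longleftrightarrow> q \<in> \<Omega>"
proof -
  have "infdist q (frontier \<Omega>) > 0" if "q \<in> \<Omega>"
    using that assms infdist_pos_not_in_closed[of "frontier \<Omega>" q]
    by (auto simp: frontier_def interior_open)
  then show ?thesis
    by (auto simp: signed_dist_def not_less infdist_nonneg)
qed

text \<open>The signed distance is a single global function, so the local tubes can be united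
  without gluing; sesquiconvexity supplies a defining function near each boundary point.\<close>

lemma signed_dist_tubular:
  fixes \<Omega> :: "C2 set"
  assumes \<Omega>: "open \<Omega>" and sesq: "sesquiconvex \<Omega>"
  defines "d \<equiv> signed_dist \<Omega>"
  obtains W where "open W" "frontier \<Omega> \<subseteq> W" "smooth_on W d"
    "\<And>q. q \<in> W \<Longrightarrow> norm (grad d q) = 1"
    "\<And>q. q \<in> W \<Longrightarrow> q - d q *\<^sub>R grad d q \<in> frontier \<Omega>"
    "\<And>q. q \<in> W \<Longrightarrow> grad d (q - d q *\<^sub>R grad d q) = grad d q"
proof -
  define good where "good W \<longleftrightarrow> open W \<and> smooth_on W d \<and> (\<forall>q\<in>W. norm (grad d q) = 1 \<and>
    q - d q *\<^sub>R grad d q \<in> frontier \<Omega> \<and> grad d (q - d q *\<^sub>R grad d q) = grad d q)" for W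
  have "\<exists>W. good W \<and> p \<in> W" if p: "p \<in> frontier \<Omega>" for p
  proof -
    have "sesquiconvex_at \<Omega> p"
      using sesq p by (simp add: sesquiconvex_def)
    then obtain U \<rho> where "defining_on \<Omega> U \<rho>" "p \<in> frontier \<Omega> \<inter> U"
      using p unfolding sesquiconvex_at_def local_defining_function_def by blast
    from signed_dist_local[OF \<Omega> this] show ?thesis
      unfolding good_def d_def by (metis IntD1)
  qed
  then have cover: "frontier \<Omega> \<subseteq> \<Union>{W. good W}" by blast
  show ?thesis
  proof (rule that[of "\<Union>{W. good W}"])
    show "smooth_on (\<Union>{W. good W}) d"
      by (rule smooth_on_open_cover) (auto simp: good_def)
  qed (use cover in \<open>auto simp: good_def\<close>)
qed

section \<open>The modified distance d + M d^2\<close>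

context
  fixes W :: "C2 set" and d :: "C2 \<Rightarrow> real" and M :: real
  assumes W: "open W" and sm: "smooth_on W d"
begin

lemma smooth_on_plus_square: "smooth_on W (\<lambda>q. d q + M * (d q)\<^sup>2)"
  unfolding power2_eq_square
  by (intro smooth_on_add smooth_on_mult smooth_on_const W sm)

lemma grad_plus_square:
  assumes "q \<in> W"
  shows "grad (\<lambda>q. d q + M * (d q)\<^sup>2) q = (1 + 2 * M * d q) *\<^sub>R grad d q"
proof (rule grad_eqI)
  have "(d has_derivative (\<lambda>v. grad d q \<bullet> v)) (at q)"
    by (rule has_derivative_grad[OF smooth_on_differentiable[OF sm assms]])
  then show "((\<lambda>q. d q + M * (d q)\<^sup>2) has_derivative (\<lambda>v. (1 + 2 * M * d q) *\<^sub>R grad d q \<bullet> v)) (at q)"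
    by (auto intro!: derivative_eq_intros simp: fun_eq_iff algebra_simps power2_eq_square)
qed

text \<open>The last term comes from the rank-one part of the Hessian of the square; it is the
  squared modulus of the complex normal component.\<close>

lemma levi_plus_square:
  assumes "q \<in> W"
  shows "levi (\<lambda>q. d q + M * (d q)\<^sup>2) q a
    = (1 + 2 * M * d q) * levi d q a + 2 * M * ((grad d q \<bullet> a)\<^sup>2 + (grad d q \<bullet> (\<i> *s a))\<^sup>2)"
proof -
  have D: "(d has_derivative (\<lambda>v. grad d q \<bullet> v)) (at q)"
    by (rule has_derivative_grad[OF smooth_on_differentiable[OF sm assms]])
  have "((\<lambda>q. (1 + 2 * M * d q) *\<^sub>R grad d q) has_derivative
      (\<lambda>v. (1 + 2 * M * d q) *\<^sub>R dir_deriv (grad d) v q + (2 * M * (grad d q \<bullet> v)) *\<^sub>R grad d q)) (at q)"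
    using D by (auto intro!: derivative_eq_intros smooth_on_has_derivative[OF smooth_on_grad[OF W sm] assms])
  from dir_deriv_eq[OF this]
  have "dir_deriv (grad (\<lambda>q. d q + M * (d q)\<^sup>2)) v q
      = (1 + 2 * M * d q) *\<^sub>R dir_deriv (grad d) v q + (2 * M * (grad d q \<bullet> v)) *\<^sub>R grad d q" for v
    using dir_deriv_local[OF W assms grad_plus_square] by simp
  then show ?thesis
    by (simp add: levi_def inner_add_left power2_eq_square algebra_simps)
qed

end

theorem corollary7p15:
  fixes \<Omega> :: "C2 set"
  assumes "smoothly_bounded_domain \<Omega>"
    and "sesquiconvex \<Omega>"
  shows "\<exists>U \<rho>. global_defining_function \<Omega> U \<rho> \<and> plurisubharmonic_on (closure \<Omega> \<inter> U) \<rho>"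
proof -
  define d where "d = signed_dist \<Omega>"
  have \<Omega>: "open \<Omega>" "bounded \<Omega>" "\<Omega> \<noteq> {}"
    using assms(1) by (auto simp: smoothly_bounded_domain_def)
  then have ne: "frontier \<Omega> \<noteq> {}"
    using frontier_eq_empty[of \<Omega>] not_bounded_UNIV by metis
  have d_neg: "d q < 0 \<longleftrightarrow> q \<in> \<Omega>" for q
    unfolding d_def by (rule signed_dist_neg_iff[OF \<Omega>(1) ne])
  have d_zero: "d q = 0" if "q \<in> frontier \<Omega>" for q
    unfolding d_def by (rule signed_dist_frontier[OF \<Omega>(1) that])
  obtain W where W: "open W" "frontier \<Omega> \<subseteq> W" "smooth_on W d"
    "\<And>q. q \<in> W \<Longrightarrow> norm (grad d q) = 1"
    "\<And>q. q \<in> W \<Longrightarrow> q - d q *\<^sub>R grad d q \<in> frontier \<Omega>"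
    "\<And>q. q \<in> W \<Longrightarrow> grad d (q - d q *\<^sub>R grad d q) = grad d q"
    unfolding d_def using signed_dist_tubular[OF \<Omega>(1) assms(2)] by metis
  have foot_W: "q - d q *\<^sub>R grad d q \<in> W" if "q \<in> W" for q
    using W(2,5) that by blast
  obtain C where C: "C > 0"
    "\<And>p. p \<in> frontier \<Omega> \<Longrightarrow> \<exists>L. L \<noteq> 0 \<and> grad d p \<bullet> L = 0 \<and> grad d p \<bullet> (\<i> *s L) = 0 \<and> 0 \<le> levi d p L \<and>
      (dir_deriv (grad d) L p \<bullet> (\<i> *s grad d p))\<^sup>2 + (dir_deriv (grad d) (\<i> *s L) p \<bullet> (\<i> *s grad d p))\<^sup>2
        \<le> C * levi d p L"
    unfolding d_def using sesquiconvex_mixed_bound[OF \<Omega>(1,2) assms(2)] by metis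
  obtain B where B: "B \<ge> 0" "\<And>p v. p \<in> frontier \<Omega> \<Longrightarrow> norm (dir_deriv (grad d) v p) \<le> B * norm v"
  proof (rule linear_family_bounded[of "frontier \<Omega>" "\<lambda>p v. dir_deriv (grad d) v p"])
    show "compact (frontier \<Omega>)" by (rule compact_frontier_bounded[OF \<Omega>(2)])
    show "linear (\<lambda>v. dir_deriv (grad d) v p)" if "p \<in> frontier \<Omega>" for p
      using that W(2) by (intro linear_dir_deriv_grad[OF W(1,3)]) auto
    show "continuous_on (frontier \<Omega>) (\<lambda>p. dir_deriv (grad d) v p)" for v
      by (rule continuous_on_subset[OF smooth_on_continuous_on[OF smooth_on_dir_deriv[OF
              smooth_on_grad[OF W(1,3)]]] W(2)])
  qed blast
  have lower: "levi d p a \<ge> - (C + B) * ((grad d p \<bullet> a)\<^sup>2 + (grad d p \<bullet> (\<i> *s a))\<^sup>2)"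
    if p: "p \<in> frontier \<Omega>" for p a
  proof -
    have pW: "p \<in> W" using p W(2) by auto
    note ctx = linear_dir_deriv_grad[OF W(1,3) pW] dir_deriv_grad_sym[OF W(1,3) pW]
    have hg: "dir_deriv (grad d) (grad d p) p = 0"
      by (rule hess_grad[OF W(1,3,4) foot_W W(6) pW])
    obtain L where L: "L \<noteq> 0" "grad d p \<bullet> L = 0" "grad d p \<bullet> (\<i> *s L) = 0"
      "(dir_deriv (grad d) L p \<bullet> (\<i> *s grad d p))\<^sup>2 + (dir_deriv (grad d) (\<i> *s L) p \<bullet> (\<i> *s grad d p))\<^sup>2
        \<le> C * levi d p L"
      using C(2)[OF p] by blast
    \<comment> \<open>The entry in the rotated normal direction plays the role of \<open>K\<close>;
      that direction is a unit vector, so the Hessian bound \<open>B\<close> serves.\<close>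
    have "\<bar>dir_deriv (grad d) (\<i> *s grad d p) p \<bullet> (\<i> *s grad d p)\<bar>
        \<le> norm (dir_deriv (grad d) (\<i> *s grad d p) p) * norm (\<i> *s grad d p)"
      by (rule Cauchy_Schwarz_ineq2)
    also have "\<dots> \<le> B"
      using B(2)[OF p, of "\<i> *s grad d p"] W(4)[OF pW] by (simp add: J_simps(6))
    finally show ?thesis
      unfolding levi_eq_qf[OF W(1,3) pW]
      using qf_lower_bound[OF ctx W(4)[OF pW] hg L(1-3) C(1)] L(4)[unfolded levi_eq_qf[OF W(1,3) pW]]
      by blast
  qed
  \<comment> \<open>This is the constant of \<open>lower\<close>; the square contributes twice as
    much.\<close>
  define M where "M = C + B"
  have M: "M > 0" using C(1) B(1) by (simp add: M_def)
  define \<rho> where "\<rho> = (\<lambda>q. d q + M * (d q)\<^sup>2)"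
  \<comment> \<open>The first condition is the one needed for monotonicity of the Hessian; the
    second keeps \<open>1 + 2 * M * d q\<close> positive, and also \<open>1 + M * d q\<close>, so
    that \<open>\<rho>\<close> has the sign of \<open>d\<close>.\<close>
  define U where "U = W \<inter> d -` {q. \<bar>q\<bar> * B < 1 \<and> 2 * M * \<bar>q\<bar> < 1}"
  have "open {q::real. \<bar>q\<bar> * B < 1 \<and> 2 * M * \<bar>q\<bar> < 1}"
    by (intro open_Collect_conj open_Collect_less continuous_intros)
  then have U: "open U"
    unfolding U_def by (intro continuous_open_preimage[OF smooth_on_continuous_on[OF W(3)] W(1)])
  have UW: "U \<subseteq> W" by (auto simp: U_def)
  have pos: "1 + M * d q > 0" "1 + 2 * M * d q > 0" if "q \<in> U" for q
  proof -
    have "2 * (M * \<bar>d q\<bar>) < 1" using that by (simp add: U_def)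
    moreover have "\<bar>M * d q\<bar> = M * \<bar>d q\<bar>" using M by (simp add: abs_mult)
    ultimately show "1 + M * d q > 0" "1 + 2 * M * d q > 0" by linarith+
  qed
  have \<rho>_neg: "\<rho> q < 0 \<longleftrightarrow> q \<in> \<Omega>" if "q \<in> U" for q
  proof -
    have "\<rho> q = d q * (1 + M * d q)"
      by (simp add: \<rho>_def power2_eq_square algebra_simps)
    then show ?thesis
      using pos(1)[OF that] d_neg[of q] by (simp add: mult_less_0_iff not_less)
  qed
  have sm\<rho>: "smooth_on U \<rho>"
    unfolding \<rho>_def by (rule smooth_on_subset[OF smooth_on_plus_square[OF W(1,3)] UW])
  have "frechet_derivative \<rho> (at q) \<noteq> (\<lambda>v. 0)" if "q \<in> frontier \<Omega> \<inter> U" for q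
  proof -
    have "q \<in> W" using that UW by auto
    have "dir_deriv \<rho> (grad d q) q = grad \<rho> q \<bullet> grad d q"
      using that by (intro dir_deriv_eq_grad smooth_on_differentiable[OF sm\<rho>]) simp
    also have "\<dots> = 1"
      using grad_plus_square[OF W(1,3) \<open>q \<in> W\<close>, of M] d_zero[of q] W(4)[OF \<open>q \<in> W\<close>] that
      by (simp add: \<rho>_def dot_square_norm)
    finally show ?thesis
      by (auto simp: dir_deriv_def)
  qed
  moreover have "frontier \<Omega> \<subseteq> U"
    using W(2) d_zero by (auto simp: U_def)
  ultimately have "global_defining_function \<Omega> U \<rho>"
    using U sm\<rho> \<rho>_neg unfolding global_defining_function_def defining_on_def by auto
  moreover have "plurisubharmonic_on (closure \<Omega> \<inter> U) \<rho>"
    unfolding plurisubharmonic_on_def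
  proof (intro ballI allI)
    fix q A assume q: "q \<in> closure \<Omega> \<inter> U"
    then have "q \<in> U" "q \<in> W" using UW by auto
    define p where "p = q - d q *\<^sub>R grad d q"
    have p: "p \<in> frontier \<Omega>" "grad d p = grad d q"
      using W(5,6)[OF \<open>q \<in> W\<close>] by (auto simp: p_def)
    have "q \<in> \<Omega> \<or> q \<in> frontier \<Omega>"
      using q by (auto simp: frontier_def interior_open[OF \<Omega>(1)])
    then have dq: "d q \<le> 0"
      using d_neg[of q] d_zero[of q] by auto
    have "\<bar>d q\<bar> * B \<le> 1" using \<open>q \<in> U\<close> by (simp add: U_def)
    then have mono: "dir_deriv (grad d) v p \<bullet> v \<le> dir_deriv (grad d) v q \<bullet> v" for v
      using hess_foot_mono[OF W(1,3,4) foot_W W(6) \<open>q \<in> W\<close> dq, of B] B(2) p(1) unfolding p_def by blast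
    let ?E = "(grad d q \<bullet> A)\<^sup>2 + (grad d q \<bullet> (\<i> *s A))\<^sup>2"
    have "levi d p A \<le> levi d q A"
      unfolding levi_def by (intro add_mono mono)
    \<comment> \<open>The gradient is constant along the normal, so \<open>?E\<close> is the same at
      \<open>p\<close> and \<open>q\<close> and the boundary estimate moves inside without
      error.\<close>
    then have "- M * ?E \<le> levi d q A"
      using lower[OF p(1), of A] by (simp add: p(2) M_def)
    then have "(1 + 2 * M * d q) * (- M * ?E) \<le> (1 + 2 * M * d q) * levi d q A"
      using pos(2)[OF \<open>q \<in> U\<close>] by (intro mult_left_mono) auto
    \<comment> \<open>On the inner side the factor is at most 1, and shrinking a nonpositive number
      increases it.\<close>
    moreover have "1 * (- M * ?E) \<le> (1 + 2 * M * d q) * (- M * ?E)"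
      using M dq by (intro mult_right_mono_neg) (auto simp: mult_nonneg_nonpos)
    moreover have "0 \<le> M * ?E" using M by simp
    ultimately have "0 \<le> levi \<rho> q A"
      unfolding \<rho>_def levi_plus_square[OF W(1,3) \<open>q \<in> W\<close>] by linarith
    then show "0 \<le> complex_hessian \<rho> q A A"
      unfolding complex_hessian_eq_levi[OF U sm\<rho> \<open>q \<in> U\<close>] by (simp add: less_eq_complex_def)
  qed
  ultimately show ?thesis by blast
qed

end
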